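(* Let $n,m\ge1$ be integers, $0\le\alpha<nm$, $1<p_i<\infty$ for $i=1,\dots,m$, $\frac1p=\sum_{i=1}^m\frac1{p_i}$, and let $q$ be a real number with $\frac1m<p\le q<\infty$. Let $B$, $A_i$, $C_i$ ($i=1,\dots,m$) be Young functions such that $A_i^{-1}(t)C_i^{-1}(t)\le B^{-1}(t)$ for all $t>0$, and such that $C_i$ is doubling and satisfies the $B_{p_i}$ condition, for every $i=1,\dots,m$. Let $\nu,w_1,\dots,w_m$ be weights on $\mathbb{R}^n$ satisfying $$\sup_Q|Q|^{\alpha/n+1/q-1/p}\left(\frac1{|Q|}\int_Q\nu^q\right)^{1/q}\prod_{i=1}^m\|w_i^{-1}\|_{A_i,Q}<\infty,$$ the supremum being over all cubes $Q\subset\mathbb{R}^n$. Then there is a constant $C>0$ such that $$\|\mathcal{M}_{\alpha,B}\vec f\;\nu\|_{L^q}\le C\prod_{i=1}^m\|f_iw_i\|_{L^{p_i}}$$ for every $\vec f=(f_1,\dots,f_m)\in L^{p_1}(w_1^{p_1})\times\dots\times L^{p_m}(w_m^{p_m})$.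
   Context: A weight is a nonnegative measurable function on $\mathbb{R}^n$; the $w_i$ are understood to be positive a.e., since $w_i^{-1}$ occurs. Cubes have sides parallel to the axes. A Young function is a function $B:[0,\infty)\to[0,\infty)$ of the form $B(t)=\int_0^t b(s)\,ds$ with $b$ nontrivial, nonnegative and increasing (in the wide sense, so $B(t)=t$ is allowed). $B$ is doubling if $B(2t)\le CB(t)$ for some constant $C$ and all $t\ge0$. For $1<r<\infty$, $B$ satisfies the $B_r$ condition if $\int_c^\infty\frac{B(t)}{t^r}\frac{dt}{t}<\infty$ for some $c>0$. For a cube $Q$, $\|f\|_{B,Q}=\inf\{\lambda>0:\frac1{|Q|}\int_Q B(|f|/\lambda)\le1\}$. $\mathcal{M}_{\alpha,B}\vec f(x)=\sup_{Q\ni x}|Q|^{\alpha/n}\prod_{i=1}^m\|f_i\|_{B,Q}$, the supremum over all cubes $Q\ni x$. $L^{p}(v)$ denotes the $L^p$ space with respect to $v(x)\,dx$. *)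

theory Defs
  imports "HOL-Analysis.Analysis"
begin

definition cubes :: "(real ^ 'n) set set" where
  "cubes = {cbox a (\<chi> i. a $ i + l) | a l. 0 < l}"

definition weight :: "(real ^ 'n \<Rightarrow> real) \<Rightarrow> bool" where
  "weight w \<longleftrightarrow> w \<in> borel_measurable lebesgue \<and> (\<forall>x. 0 \<le> w x)"

(* Functions on [0,\<infinity>) are represented by total functions on the reals whose values at
   negative arguments are irrelevant. *)

definition young_function :: "(real \<Rightarrow> real) \<Rightarrow> bool" where
  "young_function B \<longleftrightarrow> (\<exists>b. mono_on {0..} b \<and> (\<forall>s\<ge>0. 0 \<le> b s) \<and> (\<exists>s\<ge>0. b s \<noteq> 0) \<and>
     (\<forall>t\<ge>0. (b has_integral B t) {0..t}))"

(* A Young function may vanish on an interval [0,a], but every t > 0 has exactly one preimage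
   in [0,\<infinity>), so the choice made by inv_into matters only for t = 0. *)
definition young_inv :: "(real \<Rightarrow> real) \<Rightarrow> real \<Rightarrow> real" where
  "young_inv B = inv_into {0..} B"

definition doubling :: "(real \<Rightarrow> real) \<Rightarrow> bool" where
  "doubling B \<longleftrightarrow> (\<exists>K. \<forall>t\<ge>0. B (2 * t) \<le> K * B t)"

definition B_condition :: "real \<Rightarrow> (real \<Rightarrow> real) \<Rightarrow> bool" where
  "B_condition r B \<longleftrightarrow>
     (\<exists>c>0. (\<integral>\<^sup>+ t\<in>{c..}. ennreal (B t / t powr r / t) \<partial>lborel) < \<infinity>)"

(* The infimum is taken in [0,\<infinity>]; it is \<infinity> if no \<mu> is admissible. *)
definition luxemburg_norm ::
    "(real \<Rightarrow> real) \<Rightarrow> (real ^ 'n) set \<Rightarrow> (real ^ 'n \<Rightarrow> 'b::real_normed_vector) \<Rightarrow> ennreal" where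
  "luxemburg_norm B Q f = Inf {ennreal \<mu> | \<mu>. 0 < \<mu> \<and>
     (\<integral>\<^sup>+ x\<in>Q. ennreal (B (norm (f x) / \<mu>)) \<partial>lebesgue) / emeasure lebesgue Q \<le> 1}"

definition multi_maximal ::
    "real \<Rightarrow> (real \<Rightarrow> real) \<Rightarrow> nat \<Rightarrow> (nat \<Rightarrow> real ^ 'n \<Rightarrow> 'b::real_normed_vector) \<Rightarrow> real ^ 'n \<Rightarrow> ennreal"
  where
  "multi_maximal \<alpha> B m f x = (SUP Q\<in>{Q\<in>cubes. x \<in> Q}.
     ennreal (measure lebesgue Q powr (\<alpha> / real CARD('n))) * (\<Prod>i=1..m. luxemburg_norm B Q (f i)))"

(* x^r on [0,\<infinity>] for exponents r > 0 *)
definition ennpowr :: "ennreal \<Rightarrow> real \<Rightarrow> ennreal" where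
  "ennpowr x r = (if x = \<infinity> then \<infinity> else ennreal (enn2real x powr r))"

definition Lp_norm :: "real \<Rightarrow> (real ^ 'n \<Rightarrow> ennreal) \<Rightarrow> ennreal" where
  "Lp_norm p g = ennpowr (\<integral>\<^sup>+ x. ennpowr (g x) p \<partial>lebesgue) (1 / p)"

definition weighted_Lp ::
    "real \<Rightarrow> (real ^ 'n \<Rightarrow> real) \<Rightarrow> (real ^ 'n \<Rightarrow> 'b::real_normed_vector) set" where
  "weighted_Lp p v = {f \<in> borel_measurable lebesgue.
     (\<integral>\<^sup>+ x. ennreal (norm (f x) powr p * v x) \<partial>lebesgue) < \<infinity>}"

end

(* Fix one of finitely many shifted dyadic grids; every cube lies in a cube of comparable size from
   one of them. In a finite subfamily of a grid, keep those cubes Q on which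
   c(Q) = |Q|^(alpha/n) * prod ||f_i||_{B,Q} exceeds (4m)^m times its value on every larger kept cube.
   By convexity of B the kept cubes are sparse: those strictly inside a kept cube cover at most half
   of it. Hence the maximal function to the power q integrates against nu^q to at most a constant times
   the sum of c(Q)^q * nu^q(Q) over the kept cubes. Hoelder's inequality for Luxemburg norms and the
   weight condition bound each term by (|Q| * prod ||f_i w_i||_{C_i,Q}^p)^(q/p), the outer power q/p >= 1
   is pulled out of the sum, and Hoelder's inequality for sums reduces everything to the Carleson
   embedding sum |Q| * ||g||_{C_i,Q}^(p_i) <= K * int |g|^(p_i) over a sparse family. The latter follows
   from the weak-type bound for the C_i-maximal function and the B_{p_i} condition. *)

theory Submission
  imports Defs
begin

section \<open>Young functions and Luxemburg norms\<close>

text \<open>An infinite grid need not contain maximal cubes. The selection is therefore made inside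
  finite subfamilies, with constants that do not depend on the subfamily, and monotone convergence
  reaches the whole grid. A kept cube is compared with every larger kept cube, not only with the
  nearest one, so sparseness below any kept cube follows at once, without generations of stopping
  cubes. Luxemburg norms take values in [0,\<infinity>], where 0 times \<infinity> is 0. A vanishing
  norm thus needs its own argument: the function vanishes a.e. on the set. The B_r condition
  controls C only near \<infinity>, while C(u) u^(-r-1) may fail to be integrable near 0, as for
  C(u) = u and r > 1. For this reason the weak-type bound discards the small values of g. Grid boxes
  are half-open, which makes any two of them exactly nested or disjoint. They differ from closed
  cubes by null sets, so the weight condition carries over to them.\<close>

lemma young_function_at_0:
  assumes "young_function B"
  shows "B 0 = 0"
proof -
  obtain b where "\<forall>t\<ge>0. (b has_integral B t) {0..t}"
    using assms by (auto simp: young_function_def)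
  then have "(b has_integral B 0) {0..0}" by blast
  then show ?thesis by (simp add: has_integral_is_0 has_integral_iff)
qed

text \<open>The density at either endpoint is a slope that bounds the increment from one side. This
  is convexity in the form from which monotonicity, scaling and growth are derived.\<close>

lemma young_function_increment:
  assumes "young_function B"
  obtains b where "mono_on {0..} b" "\<And>s. 0 \<le> s \<Longrightarrow> 0 \<le> b s" "\<exists>s\<ge>0. b s > 0"
    "\<And>s t. 0 \<le> s \<Longrightarrow> s \<le> t \<Longrightarrow> b s * (t - s) \<le> B t - B s"
    "\<And>s t. 0 \<le> s \<Longrightarrow> s \<le> t \<Longrightarrow> B t - B s \<le> b t * (t - s)"
proof -
  obtain b where b: "mono_on {0..} b" "\<forall>s\<ge>0. 0 \<le> b s" "\<exists>s\<ge>0. b s \<noteq> 0"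
      and int: "\<forall>t\<ge>0. (b has_integral B t) {0..t}"
    using assms by (auto simp: young_function_def)
  have incr: "(b has_integral (B t - B s)) {s..t}" if "0 \<le> s" "s \<le> t" for s t
  proof -
    have i: "b integrable_on {0..t}" using int that by (meson has_integral_integrable order_trans)
    then have ist: "b integrable_on {s..t}"
      using integrable_subinterval_real that by (metis atLeastatMost_subset_iff order_refl)
    have "integral {0..s} b + integral {s..t} b = integral {0..t} b"
      using Henstock_Kurzweil_Integration.integral_combine[OF that i] .
    moreover have "integral {0..s} b = B s" "integral {0..t} b = B t"
      using int that by (auto intro!: integral_unique)
    ultimately show ?thesis using ist by (metis add_diff_cancel_left' integrable_integral)
  qed
  have lo: "b s * (t - s) \<le> B t - B s" if "0 \<le> s" "s \<le> t" for s t
    using has_integral_le[OF has_integral_const_real[of "b s" s t] incr[OF that]] b(1) that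
    by (auto simp: mono_on_def mult.commute)
  have hi: "B t - B s \<le> b t * (t - s)" if "0 \<le> s" "s \<le> t" for s t
    using has_integral_le[OF incr[OF that] has_integral_const_real[of "b t" s t]] b(1) that
    by (auto simp: mono_on_def mult.commute)
  show ?thesis
    using that[OF b(1) _ _ lo hi] b(2,3) by fastforce
qed

lemma young_function_mono:
  assumes "young_function B" "0 \<le> s" "s \<le> t"
  shows "B s \<le> B t"
proof -
  obtain b where b: "\<And>s. 0 \<le> s \<Longrightarrow> 0 \<le> b s"
    "\<And>s t. 0 \<le> s \<Longrightarrow> s \<le> t \<Longrightarrow> b s * (t - s) \<le> B t - B s"
    using young_function_increment[OF assms(1)] by metis
  show ?thesis using b(1)[OF assms(2)] b(2)[OF assms(2,3)] assms(3)
    by (smt (verit) mult_nonneg_nonneg)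
qed

lemma young_function_nonneg: "young_function B \<Longrightarrow> 0 \<le> t \<Longrightarrow> 0 \<le> B t"
  using young_function_mono[of B 0 t] young_function_at_0[of B] by simp

text \<open>The slope \<open>b (\<theta> * t)\<close> bounds the growth on [0, \<theta>t] from above
  and on [\<theta>t, t] from below. In the norm estimates this is how convexity enters: enlarging
  the level by a factor D divides the integral by at least D.\<close>

lemma young_function_scale:
  assumes "young_function B" "0 \<le> \<theta>" "\<theta> \<le> 1" "0 \<le> t"
  shows "B (\<theta> * t) \<le> \<theta> * B t"
proof -
  obtain b where b: "\<And>s t. 0 \<le> s \<Longrightarrow> s \<le> t \<Longrightarrow> b s * (t - s) \<le> B t - B s"
    "\<And>s t. 0 \<le> s \<Longrightarrow> s \<le> t \<Longrightarrow> B t - B s \<le> b t * (t - s)"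
    using young_function_increment[OF assms(1)] by metis
  have le: "\<theta> * t \<le> t" "0 \<le> \<theta> * t" using assms by (auto simp: mult_left_le_one_le)
  have "(1 - \<theta>) * B (\<theta> * t) \<le> (1 - \<theta>) * (b (\<theta> * t) * (\<theta> * t))"
    using b(2)[of 0 "\<theta> * t"] le(2) young_function_at_0[OF assms(1)] assms(3)
    by (intro mult_left_mono) auto
  also have "\<dots> = \<theta> * (b (\<theta> * t) * (t - \<theta> * t))" by (simp add: algebra_simps)
  also have "\<dots> \<le> \<theta> * (B t - B (\<theta> * t))"
    using b(1)[OF le(2,1)] assms(2) by (intro mult_left_mono) auto
  finally show ?thesis by (simp add: algebra_simps)
qed

lemma young_function_continuous_on:
  assumes "young_function B"
  shows "continuous_on {0..} B"
proof -
  obtain b where int: "\<forall>t\<ge>0. (b has_integral B t) {0..t}"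
    using assms by (auto simp: young_function_def)
  have "isCont (\<lambda>x. B (max 0 x)) x" for x
  proof -
    define T where "T = max 0 x + 1"
    have T: "0 \<le> T" "x < T" by (auto simp: T_def)
    have "continuous_on {0..T} (\<lambda>x. integral {0..x} b)"
      using int T by (intro indefinite_integral_continuous_1) blast
    moreover have "integral {0..t} b = B t" if "t \<in> {0..T}" for t
      using int that by (auto intro: integral_unique)
    ultimately have "continuous_on {0..T} B"
      using continuous_on_cong[of "{0..T}" "{0..T}" "\<lambda>x. integral {0..x} b" B] by simp
    then have "continuous_on {..<T} (\<lambda>x. B (max 0 x))"
      using T by (intro continuous_on_compose2[of "{0..T}" B _ "\<lambda>x. max 0 x"] continuous_intros) auto
    then show ?thesis using T by (simp add: continuous_on_eq_continuous_at)
  qed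
  then have "continuous_on {0..} (\<lambda>x. B (max 0 x))"
    by (simp add: continuous_at_imp_continuous_on)
  then show ?thesis by (rule continuous_on_eq) auto
qed

text \<open>The truncation by \<open>max 0\<close> is there because nothing is known about B at
  negative arguments.\<close>

lemma young_function_measurable:
  assumes "young_function B"
  shows "(\<lambda>x. B (max 0 x)) \<in> borel_measurable borel"
  using young_function_continuous_on[OF assms]
  by (intro borel_measurable_continuous_onI continuous_on_compose2[of "{0..}" B _ "\<lambda>x. max 0 x"] continuous_intros) auto

lemma young_function_eventually_gt:
  assumes "young_function B"
  obtains T where "0 < T" "y < B T"
proof -
  obtain b where b: "mono_on {0..} b" "\<exists>s\<ge>0. b s > 0"
    "\<And>s t. 0 \<le> s \<Longrightarrow> s \<le> t \<Longrightarrow> b s * (t - s) \<le> B t - B s"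
    using young_function_increment[OF assms] by metis
  obtain s where s: "0 \<le> s" "b s > 0" using b by auto
  \<comment> \<open>Beyond s the slope is at least \<open>b s\<close>, so a step of length 1 + |y| /
    b s raises B by more than |y|.\<close>
  define T where "T = s + 1 + \<bar>y\<bar> / b s"
  have "b s * (T - s) \<le> B T - B s"
    using s by (intro b) (auto simp: T_def field_simps intro!: add_nonneg_nonneg)
  moreover have "b s * (T - s) = b s + \<bar>y\<bar>" using s by (simp add: T_def field_simps)
  ultimately have "y < B T" using s young_function_nonneg[OF assms s(1)] by linarith
  moreover have "0 < T" using s by (simp add: T_def add_pos_nonneg)
  ultimately show ?thesis using that by blast
qed

lemma young_inv_properties:
  assumes "young_function B" "0 \<le> y"
  shows "0 \<le> young_inv B y" "B (young_inv B y) = y"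
proof -
  obtain T where T: "0 < T" "y < B T" using young_function_eventually_gt[OF assms(1)] .
  have "continuous_on {0..T} B"
    using young_function_continuous_on[OF assms(1)] by (rule continuous_on_subset) auto
  then have "\<exists>x\<ge>0. x \<le> T \<and> B x = y"
    using T assms young_function_at_0[OF assms(1)] by (intro IVT') auto
  then have y: "y \<in> B ` {0..}" by force
  show "0 \<le> young_inv B y" "B (young_inv B y) = y"
    using inv_into_into[OF y] f_inv_into_f[OF y] by (auto simp: young_inv_def)
qed

lemma young_inv_ge:
  assumes "young_function B" "0 \<le> s" "B s < y"
  shows "s \<le> young_inv B y"
proof (rule ccontr)
  have "0 \<le> y" by (rule order_trans[OF young_function_nonneg[OF assms(1,2)] less_imp_le[OF assms(3)]])
  note inv = young_inv_properties[OF assms(1) this]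
  assume "\<not> s \<le> young_inv B y"
  then have "B (young_inv B y) \<le> B s"
    using inv assms(1) by (metis linear young_function_mono)
  then show False using inv assms by simp
qed

text \<open>Young's inequality: any y above both C s and A u has inverse values at least s and u,
  hence s u is at most the inverse of B at y. The slack e keeps y positive, where the inverses are
  single-valued and the hypothesis applies.\<close>

lemma young_product_le:
  assumes B: "young_function B" and A: "young_function A" and C: "young_function C"
    and inv: "\<And>t. 0 < t \<Longrightarrow> young_inv A t * young_inv C t \<le> young_inv B t"
    and "0 \<le> s" "0 \<le> u"
  shows "B (s * u) \<le> C s + A u"
proof (rule field_le_epsilon)
  fix e :: real assume "0 < e"
  note nn = young_function_nonneg[OF C \<open>0 \<le> s\<close>] young_function_nonneg[OF A \<open>0 \<le> u\<close>]
  define y where "y = C s + A u + e"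
  have y: "0 < y" "C s < y" "A u < y" using nn \<open>0 < e\<close> by (auto simp: y_def)
  have "u * s \<le> young_inv A y * young_inv C y"
    using y A C \<open>0 \<le> s\<close> \<open>0 \<le> u\<close>
    by (intro mult_mono young_inv_ge young_inv_properties) auto
  then have "s * u \<le> young_inv B y"
    using inv[OF y(1)] by (simp only: mult.commute[of u s])
  then have "B (s * u) \<le> B (young_inv B y)"
    using \<open>0 \<le> s\<close> \<open>0 \<le> u\<close> by (auto intro!: young_function_mono[OF B])
  then show "B (s * u) \<le> C s + A u + e"
    using young_inv_properties(2)[OF B less_imp_le[OF y(1)]] by (simp only: y_def)
qed

text \<open>Passes from a bound at every level above a Luxemburg norm to a bound by the norm itself,
  whether or not the infimum is attained. An infinite norm makes the claim trivial, and a zero norm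
  is included.\<close>

lemma ennreal_le_all_gt:
  assumes "\<And>\<mu>. 0 < \<mu> \<Longrightarrow> a < ennreal \<mu> \<Longrightarrow> x \<le> ennreal (D * \<mu>)" and "0 < D"
  shows "x \<le> ennreal D * a"
proof (cases a)
  case top
  then show ?thesis using assms(2) by simp
next
  case (real r)
  show ?thesis
  proof (rule ennreal_le_epsilon)
    fix e :: real assume "0 < e"
    then have "x \<le> ennreal (D * (r + e / D))"
      using assms(2) real by (intro assms(1)) (auto simp: add_nonneg_pos ennreal_less_iff)
    also have "D * (r + e / D) = D * r + e" using assms(2) by (simp add: distrib_left)
    finally show "x \<le> ennreal D * a + ennreal e"
      using assms(2) real \<open>0 < e\<close> by (simp add: ennreal_mult)
  qed
qed

lemma ennreal_divide_le_1_iff: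
  fixes a b :: ennreal
  assumes "0 < b" "b < \<infinity>"
  shows "a / b \<le> 1 \<longleftrightarrow> a \<le> b"
proof
  assume "a / b \<le> 1"
  then have "a / b * b \<le> 1 * b" by (rule mult_right_mono) simp
  then show "a \<le> b" using assms by (simp add: ennreal_divide_times)
next
  assume "a \<le> b"
  then show "a / b \<le> 1" using assms by (metis divide_le_posI_ennreal mult.right_neutral)
qed

definition pos_lmeasurable :: "'a::euclidean_space set \<Rightarrow> bool" where
  "pos_lmeasurable Q \<longleftrightarrow> Q \<in> sets lebesgue \<and> 0 < emeasure lebesgue Q \<and> emeasure lebesgue Q < \<infinity>"

lemma pos_lmeasurableD:
  assumes "pos_lmeasurable Q"
  shows "Q \<in> sets lebesgue" "0 < emeasure lebesgue Q" "emeasure lebesgue Q < \<infinity>"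
    "emeasure lebesgue Q = ennreal (measure lebesgue Q)" "0 < measure lebesgue Q"
proof -
  show *: "Q \<in> sets lebesgue" "0 < emeasure lebesgue Q" "emeasure lebesgue Q < \<infinity>"
    using assms unfolding pos_lmeasurable_def by blast+
  show "emeasure lebesgue Q = ennreal (measure lebesgue Q)"
    using *(3) by (simp add: emeasure_eq_ennreal_measure)
  show "0 < measure lebesgue Q"
    using *(2,3) by (simp add: measure_def enn2real_positive_iff)
qed

section \<open>Luxemburg norms over sets of positive finite measure\<close>

lemma young_norm_measurable:
  fixes f :: "'a::euclidean_space \<Rightarrow> 'b::real_normed_vector"
  assumes "young_function B" "0 < \<mu>" "f \<in> borel_measurable lebesgue"
  shows "(\<lambda>x. B (norm (f x) / \<mu>)) \<in> borel_measurable lebesgue"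
proof -
  have "(\<lambda>x. B (max 0 (norm (f x) / \<mu>))) \<in> borel_measurable lebesgue"
    using assms(3) by (intro measurable_compose[OF _ young_function_measurable[OF assms(1)]]) simp
  then show ?thesis using assms(2) by (simp add: max_def)
qed

context
  fixes B :: "real \<Rightarrow> real" and Q :: "(real ^ 'n) set"
  assumes B: "young_function B" and Q: "pos_lmeasurable Q"
begin

lemma luxemburg_norm_le:
  assumes "0 < \<mu>" "(\<integral>\<^sup>+x\<in>Q. ennreal (B (norm (f x) / \<mu>)) \<partial>lebesgue) \<le> emeasure lebesgue Q"
  shows "luxemburg_norm B Q f \<le> ennreal \<mu>"
  unfolding luxemburg_norm_def
  using assms pos_lmeasurableD[OF Q] by (intro Inf_lower) (auto simp: ennreal_divide_le_1_iff)

text \<open>A strict inequality supplies an admissible level below \<mu>, and the integral decreases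
  as the level grows.\<close>

lemma luxemburg_norm_less:
  assumes "luxemburg_norm B Q f < ennreal \<mu>"
  shows "(\<integral>\<^sup>+x\<in>Q. ennreal (B (norm (f x) / \<mu>)) \<partial>lebesgue) \<le> emeasure lebesgue Q"
proof -
  obtain \<mu>' where \<mu>': "0 < \<mu>'" "ennreal \<mu>' < ennreal \<mu>"
    "(\<integral>\<^sup>+x\<in>Q. ennreal (B (norm (f x) / \<mu>')) \<partial>lebesgue) / emeasure lebesgue Q \<le> 1"
    using assms unfolding luxemburg_norm_def Inf_less_iff by blast
  have "\<mu>' < \<mu>" using \<mu>' by (simp add: ennreal_less_iff)
  then have "B (norm (f x) / \<mu>) \<le> B (norm (f x) / \<mu>')" for x
    using \<mu>'(1) by (intro young_function_mono[OF B]) (auto intro: divide_left_mono)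
  then have "(\<integral>\<^sup>+x\<in>Q. ennreal (B (norm (f x) / \<mu>)) \<partial>lebesgue)
    \<le> (\<integral>\<^sup>+x\<in>Q. ennreal (B (norm (f x) / \<mu>')) \<partial>lebesgue)"
    by (intro nn_integral_mono mult_right_mono ennreal_leI) auto
  also have "\<dots> \<le> emeasure lebesgue Q"
    using \<mu>'(3) pos_lmeasurableD[OF Q] by (simp add: ennreal_divide_le_1_iff)
  finally show ?thesis .
qed

lemma luxemburg_norm_greater:
  assumes "ennreal \<mu> < luxemburg_norm B Q f" "0 < \<mu>"
  shows "emeasure lebesgue Q < (\<integral>\<^sup>+x\<in>Q. ennreal (B (norm (f x) / \<mu>)) \<partial>lebesgue)"
  using luxemburg_norm_le[of \<mu> f] assms by (meson linorder_not_le)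

end

context
  fixes B :: "real \<Rightarrow> real" and Q :: "(real ^ 'n) set"
  assumes B: "young_function B" and Q: "pos_lmeasurable Q"
begin

text \<open>Multiplying the level by D divides the integral over R by at least D, which compensates
  for the loss of measure from R to Q.\<close>

lemma luxemburg_norm_superset:
  assumes R: "pos_lmeasurable R" and "Q \<subseteq> R" "1 \<le> D"
    and le: "emeasure lebesgue R \<le> ennreal D * emeasure lebesgue Q"
    and f: "f \<in> borel_measurable lebesgue"
  shows "luxemburg_norm B Q f \<le> ennreal D * luxemburg_norm B R f"
proof (rule ennreal_le_all_gt)
  fix \<mu> assume \<mu>: "0 < \<mu>" "luxemburg_norm B R f < ennreal \<mu>"
  have "(\<integral>\<^sup>+x\<in>Q. ennreal (B (norm (f x) / (D * \<mu>))) \<partial>lebesgue)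
      \<le> (\<integral>\<^sup>+x. ennreal (1 / D) * (ennreal (B (norm (f x) / \<mu>)) * indicator R x) \<partial>lebesgue)"
  proof (rule nn_integral_mono)
    fix x
    have "B (norm (f x) / (D * \<mu>)) \<le> 1 / D * B (norm (f x) / \<mu>)"
      using young_function_scale[OF B, of "1 / D" "norm (f x) / \<mu>"] \<mu> \<open>1 \<le> D\<close>
      by (simp add: field_simps)
    then show "ennreal (B (norm (f x) / (D * \<mu>))) * indicator Q x
        \<le> ennreal (1 / D) * (ennreal (B (norm (f x) / \<mu>)) * indicator R x)"
      using \<open>Q \<subseteq> R\<close> \<open>1 \<le> D\<close> \<mu> young_function_nonneg[OF B]
      by (auto simp: indicator_def ennreal_mult[symmetric] intro!: ennreal_leI)
  qed
  also have "\<dots> = ennreal (1 / D) * (\<integral>\<^sup>+x\<in>R. ennreal (B (norm (f x) / \<mu>)) \<partial>lebesgue)"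
    using young_norm_measurable[OF B \<mu>(1) f] pos_lmeasurableD(1)[OF R]
    by (intro nn_integral_cmult) auto
  also have "\<dots> \<le> ennreal (1 / D) * (ennreal D * emeasure lebesgue Q)"
    using luxemburg_norm_less[OF B R \<mu>(2)] le by (intro mult_left_mono) auto
  also have "\<dots> = emeasure lebesgue Q"
    using \<open>1 \<le> D\<close> by (simp add: mult.assoc[symmetric] ennreal_mult[symmetric])
  finally show "luxemburg_norm B Q f \<le> ennreal (D * \<mu>)"
    using \<mu> \<open>1 \<le> D\<close> by (intro luxemburg_norm_le[OF B Q]) auto
qed (use \<open>1 \<le> D\<close> in auto)

lemma luxemburg_norm_zero:
  assumes "AE x in lebesgue. x \<in> Q \<longrightarrow> norm (f x) = 0"
  shows "luxemburg_norm B Q f = 0"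
proof -
  have "luxemburg_norm B Q f \<le> ennreal 1 * 0"
  proof (rule ennreal_le_all_gt)
    fix \<mu> :: real assume "0 < \<mu>"
    have "(\<integral>\<^sup>+x\<in>Q. ennreal (B (norm (f x) / \<mu>)) \<partial>lebesgue) = (\<integral>\<^sup>+x. 0 \<partial>(lebesgue :: (real^'n) measure))"
      using assms by (intro nn_integral_cong_AE) (auto simp: young_function_at_0[OF B] indicator_def)
    then show "luxemburg_norm B Q f \<le> ennreal (1 * \<mu>)"
      using \<open>0 < \<mu>\<close> by (intro luxemburg_norm_le[OF B Q]) auto
  qed simp
  then show ?thesis by simp
qed

text \<open>B may vanish on an interval, so smallness of the Young integrals says nothing pointwise.
  Instead B grows at least linearly beyond T, whence the norm dominates the integral of |f| up to
  the factor K.\<close>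

lemma luxemburg_norm_eq_0D:
  assumes f: "f \<in> borel_measurable lebesgue" and 0: "luxemburg_norm B Q f = 0"
  shows "AE x in lebesgue. x \<in> Q \<longrightarrow> norm (f x) = 0"
proof -
  obtain T where T: "0 < T" "1 < B T" using young_function_eventually_gt[OF B] .
  \<comment> \<open>The 2 adds the two contributions |Q| that arise below: the one of the constant 1
    and the one of the Young integral.\<close>
  define K where "K = 2 * T * measure lebesgue Q"
  have K: "0 < K" using T pos_lmeasurableD(5)[OF Q] by (simp add: K_def)
  have "(\<integral>\<^sup>+x\<in>Q. ennreal (norm (f x)) \<partial>lebesgue) \<le> ennreal K * luxemburg_norm B Q f"
  proof (rule ennreal_le_all_gt)
    fix \<mu> :: real assume \<mu>: "0 < \<mu>" "luxemburg_norm B Q f < ennreal \<mu>"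
    have "(\<integral>\<^sup>+x\<in>Q. ennreal (norm (f x)) \<partial>lebesgue)
      \<le> (\<integral>\<^sup>+x. ennreal (\<mu> * T) * (indicator Q x + ennreal (B (norm (f x) / \<mu>)) * indicator Q x) \<partial>lebesgue)"
    proof (rule nn_integral_mono)
      fix x
      have "norm (f x) / \<mu> \<le> T * (1 + B (norm (f x) / \<mu>))"
      proof (cases "norm (f x) / \<mu> \<le> T")
        case True
        moreover have "0 \<le> T * B (norm (f x) / \<mu>)"
          using T \<mu> young_function_nonneg[OF B] by simp
        ultimately show ?thesis by (simp add: distrib_left)
      next
        case False
        define s where "s = norm (f x) / \<mu>"
        have "s > T" using False by (simp add: s_def)
        \<comment> \<open>Scaling with \<theta> = T/s \<le> 1 turns B T > 1 into the linear lower
          bound B s \<ge> s/T.\<close>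
        have "B (T / s * s) \<le> T / s * B s"
          using \<open>s > T\<close> T by (intro young_function_scale[OF B]) auto
        then have "B T \<le> T * B s / s" using \<open>s > T\<close> T by simp
        then have "1 \<le> T * B s / s" using T(2) by linarith
        then have "s \<le> T * B s" using \<open>s > T\<close> T by (simp add: pos_le_divide_eq)
        then show ?thesis using T unfolding s_def[symmetric] by (simp add: distrib_left)
      qed
      then have "norm (f x) \<le> \<mu> * T * (1 + B (norm (f x) / \<mu>))"
        using \<mu> by (simp add: field_simps)
      then show "ennreal (norm (f x)) * indicator Q x
        \<le> ennreal (\<mu> * T) * (indicator Q x + ennreal (B (norm (f x) / \<mu>)) * indicator Q x)"
        using \<mu> T young_function_nonneg[OF B, of "norm (f x) / \<mu>"]
        by (auto simp: indicator_def ennreal_mult[symmetric] simp flip: ennreal_1 ennreal_plus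
            intro!: ennreal_leI)
    qed
    also have "\<dots> = ennreal (\<mu> * T) * (emeasure lebesgue Q + (\<integral>\<^sup>+x\<in>Q. ennreal (B (norm (f x) / \<mu>)) \<partial>lebesgue))"
      using young_norm_measurable[OF B \<mu>(1) f] pos_lmeasurableD(1)[OF Q]
      by (subst nn_integral_cmult) (auto simp: nn_integral_add)
    also have "\<dots> \<le> ennreal (\<mu> * T) * (emeasure lebesgue Q + emeasure lebesgue Q)"
      using luxemburg_norm_less[OF B Q \<mu>(2)] by (intro mult_left_mono add_left_mono) auto
    also have "\<dots> = ennreal (K * \<mu>)"
      using \<mu> T pos_lmeasurableD(5)[OF Q]
      by (simp add: pos_lmeasurableD(4)[OF Q] K_def ennreal_mult[symmetric] field_simps flip: ennreal_plus)
    finally show "(\<integral>\<^sup>+x\<in>Q. ennreal (norm (f x)) \<partial>lebesgue) \<le> ennreal (K * \<mu>)" .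
  qed (fact K)
  then have "(\<integral>\<^sup>+x\<in>Q. ennreal (norm (f x)) \<partial>lebesgue) = 0" using 0 by simp
  then have "AE x in lebesgue. ennreal (norm (f x)) * indicator Q x = 0"
    using f pos_lmeasurableD(1)[OF Q] by (subst (asm) nn_integral_0_iff_AE) auto
  then show ?thesis by (rule AE_mp) (auto simp: indicator_def)
qed

end

text \<open>Young's inequality is applied to g/\<mu> and u/\<mu>'. The two integrals on the right
  add up to at most 2|Q|, and the factor 2 in the level removes this 2 by scaling.\<close>

lemma luxemburg_norm_Hoelder:
  fixes Q :: "(real ^ 'n) set"
  assumes B: "young_function B" and A: "young_function A" and C: "young_function C"
    and inv: "\<And>t. 0 < t \<Longrightarrow> young_inv A t * young_inv C t \<le> young_inv B t"
    and Q: "pos_lmeasurable Q"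
    and f: "f \<in> borel_measurable lebesgue"
    and g: "g \<in> borel_measurable lebesgue"
    and u: "u \<in> borel_measurable lebesgue"
    and le: "AE x in lebesgue. norm (f x) \<le> norm (g x) * norm (u x)"
  shows "luxemburg_norm B Q f \<le> 2 * (luxemburg_norm C Q g * luxemburg_norm A Q u)"
proof -
  have *: "luxemburg_norm B Q f \<le> ennreal ((2 * \<mu>) * \<mu>')"
    if \<mu>: "0 < \<mu>" "luxemburg_norm C Q g < ennreal \<mu>" "0 < \<mu>'" "luxemburg_norm A Q u < ennreal \<mu>'"
    for \<mu> \<mu>'
  proof (rule luxemburg_norm_le[OF B Q])
    have "(\<integral>\<^sup>+x\<in>Q. ennreal (B (norm (f x) / ((2 * \<mu>) * \<mu>'))) \<partial>lebesgue)
      \<le> (\<integral>\<^sup>+x. ennreal (1 / 2) * (ennreal (C (norm (g x) / \<mu>)) * indicator Q x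
          + ennreal (A (norm (u x) / \<mu>')) * indicator Q x) \<partial>lebesgue)"
    proof (rule nn_integral_mono_AE, use le in eventually_elim)
      fix x assume x: "norm (f x) \<le> norm (g x) * norm (u x)"
      have "B (norm (f x) / ((2 * \<mu>) * \<mu>')) \<le> 1 / 2 * B (norm (f x) / (\<mu> * \<mu>'))"
        using young_function_scale[OF B, of "1 / 2" "norm (f x) / (\<mu> * \<mu>')"] \<mu>
        by (simp add: mult.assoc)
      also have "B (norm (f x) / (\<mu> * \<mu>')) \<le> B (norm (g x) / \<mu> * (norm (u x) / \<mu>'))"
        using x \<mu> by (intro young_function_mono[OF B]) (auto intro: divide_right_mono)
      also have "\<dots> \<le> C (norm (g x) / \<mu>) + A (norm (u x) / \<mu>')"
        using \<mu> by (intro young_product_le[OF B A C inv]) auto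
      finally have "B (norm (f x) / ((2 * \<mu>) * \<mu>'))
          \<le> 1 / 2 * (C (norm (g x) / \<mu>) + A (norm (u x) / \<mu>'))" by simp
      then have "ennreal (B (norm (f x) / ((2 * \<mu>) * \<mu>')))
          \<le> ennreal (1 / 2) * (ennreal (C (norm (g x) / \<mu>)) + ennreal (A (norm (u x) / \<mu>')))"
        using \<mu> young_function_nonneg[OF A, of "norm (u x) / \<mu>'"]
          young_function_nonneg[OF C, of "norm (g x) / \<mu>"]
        by (subst ennreal_plus[symmetric], simp, simp, subst ennreal_mult[symmetric])
           (auto intro: ennreal_leI)
      then show "ennreal (B (norm (f x) / ((2 * \<mu>) * \<mu>'))) * indicator Q x
        \<le> ennreal (1 / 2) * (ennreal (C (norm (g x) / \<mu>)) * indicator Q x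
          + ennreal (A (norm (u x) / \<mu>')) * indicator Q x)"
        by (cases "x \<in> Q") auto
    qed
    also have "\<dots> = ennreal (1 / 2) * ((\<integral>\<^sup>+x\<in>Q. ennreal (C (norm (g x) / \<mu>)) \<partial>lebesgue)
          + (\<integral>\<^sup>+x\<in>Q. ennreal (A (norm (u x) / \<mu>')) \<partial>lebesgue))"
      using young_norm_measurable[OF C \<mu>(1) g] young_norm_measurable[OF A \<mu>(3) u]
        pos_lmeasurableD(1)[OF Q]
      by (subst nn_integral_cmult) (auto simp: nn_integral_add)
    also have "\<dots> \<le> ennreal (1 / 2) * (emeasure lebesgue Q + emeasure lebesgue Q)"
      using luxemburg_norm_less[OF C Q \<mu>(2)] luxemburg_norm_less[OF A Q \<mu>(4)]
      by (intro mult_left_mono add_mono) auto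
    also have "\<dots> = emeasure lebesgue Q"
      unfolding pos_lmeasurableD(4)[OF Q] ennreal_plus[OF measure_nonneg measure_nonneg, symmetric]
      by (subst ennreal_mult[symmetric]) auto
    finally show "(\<integral>\<^sup>+x\<in>Q. ennreal (B (norm (f x) / ((2 * \<mu>) * \<mu>'))) \<partial>lebesgue) \<le> emeasure lebesgue Q" .
  qed (use \<mu> in auto)
  \<comment> \<open>A vanishing norm makes the right side 0 even if the other one is infinite, so f
    must then be shown to vanish a.e. on Q. Otherwise an infinite norm is harmless, and with finite
    norms the levels \<mu> and \<mu>' are sent to the norms one after the other.\<close>
  consider "luxemburg_norm C Q g = 0" | "luxemburg_norm A Q u = 0"
    | "luxemburg_norm C Q g \<noteq> 0" "luxemburg_norm A Q u \<noteq> 0"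
      "luxemburg_norm C Q g = \<infinity> \<or> luxemburg_norm A Q u = \<infinity>"
    | "luxemburg_norm C Q g \<noteq> 0" "luxemburg_norm C Q g < \<infinity>" "luxemburg_norm A Q u < \<infinity>"
    by (metis infinity_ennreal_def less_top)
  then show ?thesis
  proof cases
    case 1
    have "AE x in lebesgue. x \<in> Q \<longrightarrow> norm (f x) = 0"
      using luxemburg_norm_eq_0D[OF C Q g 1] le by eventually_elim auto
    then have "luxemburg_norm B Q f = 0" by (rule luxemburg_norm_zero[OF B Q])
    then show ?thesis by simp
  next
    case 2
    have "AE x in lebesgue. x \<in> Q \<longrightarrow> norm (f x) = 0"
      using luxemburg_norm_eq_0D[OF A Q u 2] le by eventually_elim auto
    then have "luxemburg_norm B Q f = 0" by (rule luxemburg_norm_zero[OF B Q])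
    then show ?thesis by simp
  next
    case 3
    then show ?thesis by (auto simp: ennreal_mult_eq_top_iff)
  next
    case 4
    obtain r where r: "luxemburg_norm C Q g = ennreal r" "0 < r"
      using 4(1,2) by (cases "luxemburg_norm C Q g") (auto simp: less_le)
    have "luxemburg_norm B Q f \<le> ennreal (2 * \<mu>') * luxemburg_norm C Q g"
      if "0 < \<mu>'" "luxemburg_norm A Q u < ennreal \<mu>'" for \<mu>'
    proof (rule ennreal_le_all_gt)
      fix \<mu> assume "0 < \<mu>" "luxemburg_norm C Q g < ennreal \<mu>"
      then show "luxemburg_norm B Q f \<le> ennreal (2 * \<mu>' * \<mu>)"
        using *[of \<mu> \<mu>'] that by (simp add: ac_simps)
    qed (use that in auto)
    then have "luxemburg_norm B Q f \<le> ennreal (2 * r) * luxemburg_norm A Q u"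
      using r by (intro ennreal_le_all_gt) (auto simp: ennreal_mult[symmetric] ac_simps)
    then show ?thesis using r by (simp add: ennreal_mult mult.assoc)
  qed
qed

section \<open>Laminar families and sparse stopping families\<close>

text \<open>This abstracts the order structure of a dyadic grid: the covering and stopping arguments
  see neither side lengths nor generations.\<close>

definition laminar :: "'a set set \<Rightarrow> bool" where
  "laminar F \<longleftrightarrow> (\<forall>Q\<in>F. \<forall>R\<in>F. Q \<subseteq> R \<or> R \<subseteq> Q \<or> Q \<inter> R = {})"

lemma laminar_subset: "laminar F \<Longrightarrow> G \<subseteq> F \<Longrightarrow> laminar G"
  by (auto simp: laminar_def)

lemma laminar_disjoint_cover:
  assumes "finite F" "laminar F"
  obtains G where "G \<subseteq> F" "disjoint G" "\<Union>G = \<Union>F"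
proof
  let ?G = "{Q\<in>F. \<not> (\<exists>R\<in>F. Q \<subset> R)}"
  show "?G \<subseteq> F" by auto
  show "disjoint ?G"
    using assms(2) by (simp add: disjoint_def laminar_def psubset_eq) metis
  show "\<Union>?G = \<Union>F"
  proof
    show "\<Union>F \<subseteq> \<Union>?G"
    proof
      fix x assume "x \<in> \<Union>F"
      then obtain Q where Q: "Q \<in> F" "x \<in> Q" by auto
      obtain R where R: "R \<in> F" "Q \<subseteq> R" "\<And>P. P \<in> F \<Longrightarrow> R \<subseteq> P \<Longrightarrow> R = P"
        using finite_has_maximal2[OF assms(1) Q(1)] by blast
      have "\<not> (\<exists>P\<in>F. R \<subset> P)" using R(3) by blast
      then show "x \<in> \<Union>?G" using R(1,2) Q(2) by blast
    qed
  qed auto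
qed

text \<open>The maximal members are disjoint and have the same union, so the local inequalities add
  up without an overlap constant.\<close>

lemma laminar_emeasure_Union_le:
  assumes "finite F" "laminar F" "F \<subseteq> sets M"
    and h: "h \<in> borel_measurable M"
    and le: "\<And>Q. Q \<in> F \<Longrightarrow> emeasure M Q \<le> (\<integral>\<^sup>+x\<in>Q. h x \<partial>M)"
  shows "emeasure M (\<Union>F) \<le> (\<integral>\<^sup>+x\<in>\<Union>F. h x \<partial>M)"
proof -
  obtain G where G: "G \<subseteq> F" "disjoint G" "\<Union>G = \<Union>F"
    using laminar_disjoint_cover[OF assms(1,2)] .
  have fin: "finite G" using finite_subset[OF G(1) assms(1)] .
  have dis: "disjoint_family_on (\<lambda>Q. Q) G"
    using G(2) by (simp add: disjoint_family_on_def disjoint_def)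
  have ind: "indicator (\<Union>G) x = (\<Sum>Q\<in>G. indicator Q x :: ennreal)" for x
    using indicator_UN_disjoint[OF fin dis] by simp
  have "emeasure M (\<Union>G) \<le> (\<Sum>Q\<in>G. emeasure M Q)"
    using emeasure_subadditive_finite[OF fin, of "\<lambda>Q. Q" M] G assms(3) by auto
  also have "\<dots> \<le> (\<Sum>Q\<in>G. \<integral>\<^sup>+x\<in>Q. h x \<partial>M)"
    using le G by (intro sum_mono) auto
  also have "\<dots> = (\<integral>\<^sup>+x. (\<Sum>Q\<in>G. h x * indicator Q x) \<partial>M)"
    using h G assms(3) by (intro nn_integral_sum[symmetric]) auto
  also have "\<dots> = (\<integral>\<^sup>+x\<in>\<Union>G. h x \<partial>M)"
    by (simp add: sum_distrib_left[symmetric] ind)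
  finally show ?thesis using G(3) by simp
qed

text \<open>The condition on Q refers only to kept sets strictly larger than Q, so it is a recursion
  from the top down. In the induction a minimal set is removed: putting it back cannot affect the
  condition on any other set.\<close>

lemma stopping_family_exists:
  fixes P :: "'a set \<Rightarrow> 'a set \<Rightarrow> bool"
  assumes "finite F"
  shows "\<exists>S\<subseteq>F. \<forall>Q\<in>F. Q \<in> S \<longleftrightarrow> (\<forall>R\<in>S. Q \<subset> R \<longrightarrow> P Q R)"
  using assms
proof (induction "card F" arbitrary: F)
  case 0
  then show ?case by auto
next
  case (Suc n)
  then have "F \<noteq> {}" by auto
  obtain Q where Q: "Q \<in> F" "\<And>R. R \<in> F \<Longrightarrow> R \<subseteq> Q \<Longrightarrow> Q = R"
    using finite_has_minimal[OF Suc.prems \<open>F \<noteq> {}\<close>] by blast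
  have "n = card (F - {Q})" using Suc.hyps(2) Q(1) Suc.prems by simp
  then obtain S where S: "S \<subseteq> F - {Q}"
    "\<forall>R\<in>F - {Q}. R \<in> S \<longleftrightarrow> (\<forall>R'\<in>S. R \<subset> R' \<longrightarrow> P R R')"
    using Suc.hyps(1)[of "F - {Q}"] Suc.prems by auto
  show ?case
  proof (cases "\<forall>R\<in>S. Q \<subset> R \<longrightarrow> P Q R")
    case True
    have "R \<in> insert Q S \<longleftrightarrow> (\<forall>R'\<in>insert Q S. R \<subset> R' \<longrightarrow> P R R')" if R: "R \<in> F" for R
    proof (cases "R = Q")
      case False
      have "\<not> R \<subset> Q" using Q(2)[OF R] by auto
      then show ?thesis using bspec[OF S(2), of R] R False by simp
    qed (use True in simp)
    then show ?thesis using S(1) Q(1) by (intro exI[of _ "insert Q S"]) auto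
  next
    case False
    have "Q \<notin> S" using S(1) by auto
    with False have "R \<in> S \<longleftrightarrow> (\<forall>R'\<in>S. R \<subset> R' \<longrightarrow> P R R')" if "R \<in> F" for R
      using bspec[OF S(2), of R] that by (cases "R = Q") auto
    then show ?thesis using S(1) by (intro exI[of _ S]) auto
  qed
qed

text \<open>What is left of R after removing all smaller members of S has at least half the measure
  of R, and these remainders are disjoint. A subfamily \<open>S'\<close> is allowed because the
  bound is later applied to the cubes of S with large norm.\<close>

lemma sparse_sum_le:
  assumes S: "finite S" "laminar S" "S \<subseteq> sets M" "\<And>R. R \<in> S \<Longrightarrow> emeasure M R < \<infinity>"
    and sparse: "\<And>R. R \<in> S \<Longrightarrow> 2 * emeasure M (\<Union>{Q\<in>S. Q \<subset> R}) \<le> emeasure M R"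
    and "S' \<subseteq> S"
  shows "(\<Sum>R\<in>S'. emeasure M R) \<le> 2 * emeasure M (\<Union>S')"
proof -
  define E where "E R = R - \<Union>{Q\<in>S. Q \<subset> R}" for R
  have U: "\<Union>{Q\<in>S. Q \<subset> R} \<in> sets M" for R
    using S by (intro sets.finite_Union) auto
  have E: "E R \<in> sets M" if "R \<in> S" for R
    using that U S(3) by (auto simp: E_def)
  have half: "emeasure M R \<le> 2 * emeasure M (E R)" if "R \<in> S" for R
  proof -
    let ?U = "\<Union>{Q\<in>S. Q \<subset> R}"
    have "emeasure M R = emeasure M (E R \<union> ?U)"
      by (rule arg_cong[where f = "emeasure M"]) (auto simp: E_def)
    also have "\<dots> \<le> emeasure M (E R) + emeasure M ?U"
      using E[OF that] U by (rule emeasure_subadditive)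
    finally have "2 * emeasure M R \<le> 2 * (emeasure M (E R) + emeasure M ?U)"
      by (rule mult_left_mono) simp
    also have "\<dots> = 2 * emeasure M (E R) + 2 * emeasure M ?U" by (rule distrib_left)
    also have "\<dots> \<le> 2 * emeasure M (E R) + emeasure M R"
      using sparse[OF that] by (intro add_left_mono)
    finally have "emeasure M R + emeasure M R \<le> emeasure M R + 2 * emeasure M (E R)"
      unfolding mult_2[of "emeasure M R"] by (simp only: add.commute[of "2 * emeasure M (E R)"])
    then show ?thesis
      using S(4)[OF that] by (subst (asm) ennreal_add_left_cancel_le) auto
  qed
  have dis: "disjoint_family_on E S'"
    unfolding disjoint_family_on_def
  proof (intro ballI impI)
    fix Q R assume QR: "Q \<in> S'" "R \<in> S'" "Q \<noteq> R"
    then have "Q \<subset> R \<or> R \<subset> Q \<or> Q \<inter> R = {}"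
      using S(2) \<open>S' \<subseteq> S\<close> unfolding laminar_def by blast
    then show "E Q \<inter> E R = {}" using QR \<open>S' \<subseteq> S\<close> unfolding E_def by blast
  qed
  have fin: "finite S'" using finite_subset[OF \<open>S' \<subseteq> S\<close> S(1)] .
  have "(\<Sum>R\<in>S'. emeasure M R) \<le> (\<Sum>R\<in>S'. 2 * emeasure M (E R))"
    using half \<open>S' \<subseteq> S\<close> by (intro sum_mono) auto
  also have "\<dots> = 2 * emeasure M (\<Union>R\<in>S'. E R)"
    using dis fin E \<open>S' \<subseteq> S\<close>
    by (subst sum_emeasure[symmetric]) (auto simp: sum_distrib_left)
  also have "\<dots> \<le> 2 * emeasure M (\<Union>S')"
    using S(3) \<open>S' \<subseteq> S\<close> fin
    by (intro mult_left_mono emeasure_mono sets.finite_Union) (auto simp: E_def)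
  finally show ?thesis .
qed

text \<open>Let N be the norm over R. At level 2N the integral over R is at most |R|, and at level
  2kN the integrand is smaller by the factor k, yet its mean over each Q still exceeds 1. The 2 in
  the hypothesis provides a level strictly above N. If N were 0, then f would vanish on R and on
  each Q, leaving no jump.\<close>

lemma luxemburg_norm_jump:
  fixes R :: "(real ^ 'n) set"
  assumes B: "young_function B" and R: "pos_lmeasurable R"
    and f: "f \<in> borel_measurable lebesgue"
    and G: "finite G" "laminar G" "\<And>Q. Q \<in> G \<Longrightarrow> pos_lmeasurable Q" "\<And>Q. Q \<in> G \<Longrightarrow> Q \<subseteq> R"
    and jump: "\<And>Q. Q \<in> G \<Longrightarrow> ennreal (2 * k) * luxemburg_norm B R f < luxemburg_norm B Q f"
    and k: "1 \<le> k"
  shows "ennreal k * emeasure lebesgue (\<Union>G) \<le> emeasure lebesgue R"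
proof (cases "G = {}")
  case False
  then obtain Q0 where Q0: "Q0 \<in> G" by auto
  have "luxemburg_norm B R f \<noteq> 0"
  proof
    assume "luxemburg_norm B R f = 0"
    then have "AE x in lebesgue. x \<in> R \<longrightarrow> norm (f x) = 0"
      by (rule luxemburg_norm_eq_0D[OF B R f])
    then have "AE x in lebesgue. x \<in> Q0 \<longrightarrow> norm (f x) = 0"
      by (rule eventually_mono) (use G(4)[OF Q0] in auto)
    then have "luxemburg_norm B Q0 f = 0" by (rule luxemburg_norm_zero[OF B G(3)[OF Q0]])
    then show False using jump[OF Q0] by simp
  qed
  moreover have "luxemburg_norm B R f \<noteq> \<infinity>"
    using jump[OF Q0] k by (auto simp: ennreal_mult_top)
  ultimately obtain N where N: "luxemburg_norm B R f = ennreal N" "0 < N"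
    by (cases "luxemburg_norm B R f") (auto simp: less_le)
  define h where "h x = ennreal (1 / k) * ennreal (B (norm (f x) / (2 * N)))" for x
  have hm: "h \<in> borel_measurable lebesgue"
    unfolding h_def using young_norm_measurable[OF B _ f, of "2 * N"] N by simp
  have "emeasure lebesgue (\<Union>G) \<le> (\<integral>\<^sup>+x\<in>\<Union>G. h x \<partial>lebesgue)"
  proof (rule laminar_emeasure_Union_le[OF G(1,2) _ hm])
    show "G \<subseteq> sets lebesgue" using G(3) pos_lmeasurableD(1) by blast
    fix Q assume Q: "Q \<in> G"
    have "ennreal (2 * k * N) < luxemburg_norm B Q f"
      using jump[OF Q] N k by (simp add: ennreal_mult[symmetric])
    then have "emeasure lebesgue Q \<le> (\<integral>\<^sup>+x\<in>Q. ennreal (B (norm (f x) / (2 * k * N))) \<partial>lebesgue)"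
      using N k by (intro less_imp_le luxemburg_norm_greater[OF B G(3)[OF Q]]) auto
    also have "\<dots> \<le> (\<integral>\<^sup>+x\<in>Q. h x \<partial>lebesgue)"
    proof (intro nn_integral_mono mult_right_mono)
      fix x
      have "B (norm (f x) / (2 * k * N)) \<le> 1 / k * B (norm (f x) / (2 * N))"
        using young_function_scale[OF B, of "1 / k" "norm (f x) / (2 * N)"] N k
        by (simp add: ac_simps)
      then show "ennreal (B (norm (f x) / (2 * k * N))) \<le> h x"
        unfolding h_def using N k young_function_nonneg[OF B, of "norm (f x) / (2 * N)"]
        by (subst ennreal_mult[symmetric]) (auto intro: ennreal_leI)
    qed simp
    finally show "emeasure lebesgue Q \<le> (\<integral>\<^sup>+x\<in>Q. h x \<partial>lebesgue)" .
  qed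
  also have "\<dots> \<le> (\<integral>\<^sup>+x\<in>R. h x \<partial>lebesgue)"
    using G(4) by (intro nn_integral_mono mult_left_mono) (auto simp: indicator_def)
  also have "\<dots> = ennreal (1 / k) * (\<integral>\<^sup>+x\<in>R. ennreal (B (norm (f x) / (2 * N))) \<partial>lebesgue)"
    unfolding h_def mult.assoc using young_norm_measurable[OF B _ f, of "2 * N"] N pos_lmeasurableD(1)[OF R]
    by (intro nn_integral_cmult) auto
  also have "\<dots> \<le> ennreal (1 / k) * emeasure lebesgue R"
    using N by (intro mult_left_mono luxemburg_norm_less[OF B R]) (auto simp: ennreal_less_iff)
  finally have "ennreal k * emeasure lebesgue (\<Union>G) \<le> ennreal k * (ennreal (1 / k) * emeasure lebesgue R)"
    by (rule mult_left_mono) simp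
  also have "\<dots> = emeasure lebesgue R"
    using k by (simp add: mult.assoc[symmetric] ennreal_mult[symmetric])
  finally show ?thesis .
qed simp

text \<open>Pigeonhole: as \<beta> \<ge> 0, the power of the measure cannot increase from R to Q, so
  a jump of c beyond (4m)^m forces some factor to jump beyond 4m = 2(2m). For each of the m indices
  the jumping sets cover at most 1/(2m) of R, in total at most one half.\<close>

lemma stopping_family_sparse:
  fixes F :: "(real ^ 'n) set set" and f :: "nat \<Rightarrow> real ^ 'n \<Rightarrow> 'b::real_normed_vector"
  assumes B: "young_function B"
    and F: "finite F" "laminar F" "\<And>Q. Q \<in> F \<Longrightarrow> pos_lmeasurable Q"
    and f: "\<And>i. i \<in> {1..m} \<Longrightarrow> f i \<in> borel_measurable lebesgue"
    and "0 \<le> \<beta>" "1 \<le> m"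
    and c: "\<And>Q. c Q = ennreal (measure lebesgue Q powr \<beta>) * (\<Prod>i=1..m. luxemburg_norm B Q (f i))"
    and S: "S \<subseteq> F" "\<forall>Q\<in>F. Q \<in> S \<longleftrightarrow> (\<forall>R\<in>S. Q \<subset> R \<longrightarrow> ennreal ((4 * real m) ^ m) * c R < c Q)"
    and R: "R \<in> S"
  shows "2 * emeasure lebesgue (\<Union>{Q\<in>S. Q \<subset> R}) \<le> emeasure lebesgue R"
proof -
  define G where "G i = {Q\<in>F. Q \<subseteq> R \<and>
    ennreal (2 * (2 * real m)) * luxemburg_norm B R (f i) < luxemburg_norm B Q (f i)}" for i
  have GF: "G i \<subseteq> F" for i by (auto simp: G_def)
  have sub: "\<Union>{Q\<in>S. Q \<subset> R} \<subseteq> (\<Union>i\<in>{1..m}. \<Union>(G i))"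
  proof
    fix x assume "x \<in> \<Union>{Q\<in>S. Q \<subset> R}"
    then obtain Q where Q: "Q \<in> S" "Q \<subset> R" "x \<in> Q" by auto
    have QF: "Q \<in> F" "R \<in> F" using Q R S(1) by auto
    have less: "ennreal ((4 * real m) ^ m) * c R < c Q" using S(2) Q R QF by blast
    have "\<exists>i\<in>{1..m}. ennreal (4 * real m) * luxemburg_norm B R (f i) < luxemburg_norm B Q (f i)"
    proof (rule ccontr)
      assume "\<not> ?thesis"
      then have *: "luxemburg_norm B Q (f i) \<le> ennreal (4 * real m) * luxemburg_norm B R (f i)"
        if "i \<in> {1..m}" for i using that by (meson linorder_not_le)
      have "measure lebesgue Q \<le> measure lebesgue R"
        using Q(2) pos_lmeasurableD[OF F(3)[OF QF(1)]] pos_lmeasurableD[OF F(3)[OF QF(2)]]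
        by (intro measure_mono_fmeasurable) (auto simp: fmeasurable_def)
      then have "c Q \<le> ennreal (measure lebesgue R powr \<beta>) *
          (\<Prod>i=1..m. ennreal (4 * real m) * luxemburg_norm B R (f i))"
        unfolding c using * \<open>0 \<le> \<beta>\<close>
        by (intro mult_mono prod_mono_ennreal) (auto intro!: ennreal_leI powr_mono2 prod_mono)
      also have "\<dots> = ennreal ((4 * real m) ^ m) * c R"
        unfolding c prod.distrib by (simp add: ennreal_power ac_simps)
      finally show False using less by simp
    qed
    then show "x \<in> (\<Union>i\<in>{1..m}. \<Union>(G i))" using Q QF unfolding G_def by auto
  qed
  have meas: "\<Union>(G i) \<in> sets lebesgue" for i
    using GF F(3) pos_lmeasurableD(1) finite_subset[OF GF F(1)] by (intro sets.finite_Union) auto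
  have G: "ennreal (2 * real m) * emeasure lebesgue (\<Union>(G i)) \<le> emeasure lebesgue R"
    if i: "i \<in> {1..m}" for i
  proof (rule luxemburg_norm_jump[OF B _ f[OF i]])
    show "pos_lmeasurable R" using R S(1) F(3) by auto
    show "finite (G i)" using finite_subset[OF GF F(1)] .
    show "laminar (G i)" using laminar_subset[OF F(2) GF] .
  qed (use GF F(3) \<open>1 \<le> m\<close> in \<open>auto simp: G_def\<close>)
  have "ennreal (real m) * (2 * emeasure lebesgue (\<Union>{Q\<in>S. Q \<subset> R}))
      = ennreal (2 * real m) * emeasure lebesgue (\<Union>{Q\<in>S. Q \<subset> R})"
    by (simp add: ennreal_mult ac_simps)
  also have "\<dots> \<le> ennreal (2 * real m) * (\<Sum>i=1..m. emeasure lebesgue (\<Union>(G i)))"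
    using meas sub
    by (intro mult_left_mono order_trans[OF emeasure_mono emeasure_subadditive_finite]) auto
  also have "\<dots> \<le> (\<Sum>i=1..m. emeasure lebesgue R)"
    unfolding sum_distrib_left using G by (intro sum_mono)
  also have "\<dots> = ennreal (real m) * emeasure lebesgue R"
    by (simp add: ennreal_of_nat_eq_real_of_nat)
  finally show ?thesis using \<open>1 \<le> m\<close> by (subst (asm) ennreal_mult_le_mult_iff) auto
qed

section \<open>The Carleson embedding\<close>

lemma ennpowr_ennreal: "0 \<le> x \<Longrightarrow> ennpowr (ennreal x) r = ennreal (x powr r)"
  by (simp add: ennpowr_def)

lemma ennpowr_top [simp]: "ennpowr top r = top"
  by (simp add: ennpowr_def)

lemma ennpowr_0 [simp]: "ennpowr 0 r = 0"
  by (simp add: ennpowr_def)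

lemma ennpowr_mono: "0 < r \<Longrightarrow> x \<le> y \<Longrightarrow> ennpowr x r \<le> ennpowr y r"
  by (cases x; cases y) (auto simp: ennpowr_ennreal top_unique intro!: ennreal_leI powr_mono2)

lemma ennpowr_mult: "0 < r \<Longrightarrow> ennpowr (x * y) r = ennpowr x r * ennpowr y r"
  by (cases x; cases y)
     (auto simp: ennpowr_ennreal ennreal_mult[symmetric] powr_mult ennreal_mult_top ennreal_top_mult)

lemma ennpowr_prod: "0 < r \<Longrightarrow> ennpowr (\<Prod>i\<in>I. x i) r = (\<Prod>i\<in>I. ennpowr (x i) r)"
  by (induction I rule: infinite_finite_induct)
     (auto simp: ennpowr_mult ennpowr_ennreal simp flip: ennreal_1)

lemma ennpowr_ennpowr: "ennpowr (ennpowr x r) s = ennpowr x (r * s)"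
  by (cases x) (auto simp: ennpowr_ennreal powr_powr)

lemma ennpowr_one [simp]: "ennpowr x 1 = x"
  by (cases x) (auto simp: ennpowr_ennreal)

lemma ennpowr_le_iff: "0 < r \<Longrightarrow> ennpowr x r \<le> y \<longleftrightarrow> x \<le> ennpowr y (1 / r)"
  using ennpowr_mono[of r x "ennpowr y (1 / r)"] ennpowr_mono[of "1 / r" "ennpowr x r" y]
  by (auto simp: ennpowr_ennpowr)

lemma ennpowr_le_of_real_le:
  assumes "0 < r" "\<And>y. 0 < y \<Longrightarrow> ennreal y \<le> x \<Longrightarrow> ennreal (y powr r) \<le> z"
  shows "ennpowr x r \<le> z"
proof (cases x)
  case (real a)
  then show ?thesis using assms(2)[of a] by (cases "a = 0") (auto simp: ennpowr_ennreal)
next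
  case top
  have "z = \<infinity>"
  proof (rule ccontr)
    assume "z \<noteq> \<infinity>"
    then obtain b where b: "z = ennreal b" "0 \<le> b" by (cases z) auto
    have "ennreal (((b + 1) powr (1 / r)) powr r) \<le> z"
      using b top by (intro assms(2)) auto
    then show False using b assms(1) by (simp add: powr_powr)
  qed
  then show ?thesis by simp
qed

text \<open>The layer-cake estimate is written in the variable \<open>s = 1 / t\<close>, so that the scaling that follows
  Tonelli's theorem is linear in \<open>s\<close>.\<close>
lemma ennpowr_le_layer_cake:
  assumes "0 < r"
  shows "ennpowr x r \<le> ennreal (2 powr (r + 1)) *
    (\<integral>\<^sup>+s. ennreal (s powr (- r - 1)) * indicator {s. 0 < s \<and> ennreal (1 / s) < x} s \<partial>lborel)"
proof (rule ennpowr_le_of_real_le[OF assms])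
  fix y :: real assume y: "0 < y" "ennreal y \<le> x"
  let ?I = "\<integral>\<^sup>+s. ennreal (s powr (- r - 1)) * indicator {s. 0 < s \<and> ennreal (1 / s) < x} s \<partial>lborel"
  \<comment> \<open>One interval suffices: (1/y, 2/y] has length 1/y, and s^(-r-1) is at least
    (2/y)^(-r-1) there. The product is 2^(-r-1) y^r, which explains the constant. The left end is
    open so that 1/s < y holds strictly.\<close>
  have eq: "ennreal (y powr r) = ennreal (2 powr (r + 1)) * (ennreal ((2 / y) powr (- r - 1)) * ennreal (1 / y))"
    using y(1) by (simp add: ennreal_mult[symmetric] powr_divide powr_diff powr_minus powr_add field_simps)
  have "ennreal ((2 / y) powr (- r - 1)) * ennreal (1 / y)
    = (\<integral>\<^sup>+s. ennreal ((2 / y) powr (- r - 1)) * indicator {1 / y<..2 / y} s \<partial>lborel)"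
    using y(1) by (simp add: nn_integral_cmult_indicator divide_right_mono)
  also have "\<dots> \<le> ?I"
  proof (intro nn_integral_mono)
    fix s
    show "ennreal ((2 / y) powr (- r - 1)) * indicator {1 / y<..2 / y} s
      \<le> ennreal (s powr (- r - 1)) * indicator {s. 0 < s \<and> ennreal (1 / s) < x} s"
    proof (cases "s \<in> {1 / y<..2 / y}")
      case True
      have "0 < s" using True y(1) by (auto intro: less_trans[of _ "1 / y"])
      moreover have "(2 / y) powr (- r - 1) \<le> s powr (- r - 1)"
        using True \<open>0 < s\<close> assms by (intro powr_mono2') auto
      moreover have "1 / s < y" using True \<open>0 < s\<close> y(1) by (simp add: field_simps)
      then have "ennreal (1 / s) < x" using y by (metis ennreal_lessI order_less_le_trans)
      ultimately show ?thesis using True by (simp add: ennreal_leI)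
    qed simp
  qed
  finally show "ennreal (y powr r) \<le> ennreal (2 powr (r + 1)) * ?I"
    unfolding eq by (rule mult_left_mono) simp
qed

text \<open>The threshold \<delta> separates the small values of the argument, which account for at
  most half of a mean exceeding 1, from those that are kept.\<close>

lemma young_function_small_value:
  assumes "young_function C"
  obtains \<delta> where "0 < \<delta>" "C \<delta> \<le> 1 / 2"
proof -
  define \<theta> where "\<theta> = 1 / (2 * (C 1 + 1))"
  have C1: "0 \<le> C 1" using young_function_nonneg[OF assms] by simp
  then have \<theta>: "0 < \<theta>" "\<theta> \<le> 1" by (auto simp: \<theta>_def)
  then have "C (\<theta> * 1) \<le> \<theta> * C 1" by (intro young_function_scale[OF assms]) auto
  also have "\<dots> \<le> 1 / 2" using C1 by (simp add: \<theta>_def field_simps)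
  finally show ?thesis using \<theta> that[of \<theta>] by simp
qed

text \<open>On each Q the mean of C(|g|/t) exceeds 1, and points with |g|/t \<le> \<delta>
  contribute at most 1/2 to it. The remaining points thus carry at least |Q|/2, which is the factor
  2.\<close>

lemma luxemburg_norm_weak_type:
  fixes S :: "(real ^ 'n) set set" and g :: "real ^ 'n \<Rightarrow> 'b::real_normed_vector"
  assumes C: "young_function C" and S: "finite S" "laminar S" "\<And>Q. Q \<in> S \<Longrightarrow> pos_lmeasurable Q"
    and g: "g \<in> borel_measurable lebesgue"
    and \<delta>: "C \<delta> \<le> 1 / 2" and "0 < t"
    and gt: "\<And>Q. Q \<in> S \<Longrightarrow> ennreal t < luxemburg_norm C Q g"
  shows "emeasure lebesgue (\<Union>S) \<le>
    2 * (\<integral>\<^sup>+x. ennreal (C (norm (g x) / t)) * indicator {x. \<delta> < norm (g x) / t} x \<partial>lebesgue)"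
proof -
  let ?h = "\<lambda>x. ennreal (C (norm (g x) / t)) * indicator {x. \<delta> < norm (g x) / t} x"
  have hm [measurable]: "?h \<in> borel_measurable lebesgue"
    using young_norm_measurable[OF C \<open>0 < t\<close> g] g by measurable
  have "emeasure lebesgue (\<Union>S) \<le> (\<integral>\<^sup>+x\<in>\<Union>S. (2 * ?h x) \<partial>lebesgue)"
  proof (rule laminar_emeasure_Union_le[OF S(1,2)])
    show "S \<subseteq> sets lebesgue" using S(3) pos_lmeasurableD(1) by blast
    show "(\<lambda>x. 2 * ?h x) \<in> borel_measurable lebesgue" by measurable
    fix Q assume Q: "Q \<in> S"
    note Qm = pos_lmeasurableD[OF S(3)[OF Q]]
    have "emeasure lebesgue Q \<le> (\<integral>\<^sup>+x\<in>Q. ennreal (C (norm (g x) / t)) \<partial>lebesgue)"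
      using luxemburg_norm_greater[OF C S(3)[OF Q] gt[OF Q] \<open>0 < t\<close>] by (rule less_imp_le)
    also have "\<dots> \<le> (\<integral>\<^sup>+x. ennreal (1 / 2) * indicator Q x + ?h x * indicator Q x \<partial>lebesgue)"
    proof (rule nn_integral_mono)
      fix x
      have "C (norm (g x) / t) \<le> 1 / 2" if "norm (g x) / t \<le> \<delta>"
        using young_function_mono[OF C _ that] \<delta> \<open>0 < t\<close> by simp
      then have "ennreal (C (norm (g x) / t)) \<le> ennreal (1 / 2) + ?h x"
        using ennreal_leI[of "C (norm (g x) / t)" "1 / 2"]
        by (cases "\<delta> < norm (g x) / t") (simp_all del: ennreal_half)
      then show "ennreal (C (norm (g x) / t)) * indicator Q x
          \<le> ennreal (1 / 2) * indicator Q x + ?h x * indicator Q x"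
        by (cases "x \<in> Q") simp_all
    qed
    also have "\<dots> = ennreal (1 / 2) * emeasure lebesgue Q + (\<integral>\<^sup>+x\<in>Q. ?h x \<partial>lebesgue)"
      using Qm(1) by (subst nn_integral_add) (auto simp: nn_integral_cmult_indicator)
    finally have "2 * emeasure lebesgue Q
        \<le> 2 * (ennreal (1 / 2) * emeasure lebesgue Q + (\<integral>\<^sup>+x\<in>Q. ?h x \<partial>lebesgue))"
      by (rule mult_left_mono) simp
    also have "\<dots> = emeasure lebesgue Q + 2 * (\<integral>\<^sup>+x\<in>Q. ?h x \<partial>lebesgue)"
      using ennreal_mult[of 2 "1 / 2"] by (simp add: distrib_left mult.assoc[symmetric])
    finally have "emeasure lebesgue Q \<le> 2 * (\<integral>\<^sup>+x\<in>Q. ?h x \<partial>lebesgue)"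
      unfolding mult_2[of "emeasure lebesgue Q"] using Qm(3)
      by (subst (asm) ennreal_add_left_cancel_le) auto
    also have "\<dots> = (\<integral>\<^sup>+x\<in>Q. (2 * ?h x) \<partial>lebesgue)"
      unfolding mult.assoc[of 2] using Qm(1)
      by (intro nn_integral_cmult[symmetric] borel_measurable_times_ennreal[OF hm] borel_measurable_indicator)
    finally show "emeasure lebesgue Q \<le> (\<integral>\<^sup>+x\<in>Q. (2 * ?h x) \<partial>lebesgue)" .
  qed
  also have "\<dots> \<le> (\<integral>\<^sup>+x. 2 * ?h x \<partial>lebesgue)"
    by (intro nn_integral_mono) (auto simp: indicator_def)
  also have "\<dots> = 2 * (\<integral>\<^sup>+x. ?h x \<partial>lebesgue)" by (intro nn_integral_cmult) simp
  finally show ?thesis .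
qed

lemma B_condition_integral_finite:
  assumes C: "young_function C" and "B_condition r C" "0 < \<delta>" "0 < r"
  shows "(\<integral>\<^sup>+u. ennreal (u powr (- r - 1) * C (max 0 u)) * indicator {\<delta><..} u \<partial>lborel) < \<infinity>"
proof -
  obtain c where c: "c > 0" "(\<integral>\<^sup>+t\<in>{c..}. ennreal (C t / t powr r / t) \<partial>lborel) < \<infinity>"
    using assms(2) by (auto simp: B_condition_def)
  let ?\<psi> = "\<lambda>u. ennreal (u powr (- r - 1) * C (max 0 u))"
  \<comment> \<open>\<open>?M\<close> bounds the integrand between \<delta> and the unrelated
    threshold c of the B_r condition. That range lies in the interval from \<delta> to \<delta> + c,
    whose length is c whichever of \<delta> and c is larger.\<close>
  let ?M = "\<delta> powr (- r - 1) * C c"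
  have [measurable]: "(\<lambda>u. C (max 0 u)) \<in> borel_measurable borel"
    by (rule young_function_measurable[OF C])
  have "(\<integral>\<^sup>+u. ?\<psi> u * indicator {\<delta><..} u \<partial>lborel)
      \<le> (\<integral>\<^sup>+u. ennreal ?M * indicator {\<delta>..\<delta> + c} u + ?\<psi> u * indicator {c..} u \<partial>lborel)"
  proof (rule nn_integral_mono)
    fix u
    show "?\<psi> u * indicator {\<delta><..} u \<le> ennreal ?M * indicator {\<delta>..\<delta> + c} u + ?\<psi> u * indicator {c..} u"
    proof (cases "\<delta> < u \<and> u < c")
      case True
      then have "u powr (- r - 1) * C (max 0 u) \<le> ?M"
        using \<open>0 < \<delta>\<close> \<open>0 < r\<close> c(1) young_function_nonneg[OF C, of u] young_function_mono[OF C, of u c]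
        by (intro mult_mono powr_mono2') auto
      then show ?thesis using True \<open>0 < \<delta>\<close> by (simp add: ennreal_leI)
    qed (auto simp: indicator_def)
  qed
  also have "\<dots> = ennreal ?M * ennreal c + (\<integral>\<^sup>+u. ?\<psi> u * indicator {c..} u \<partial>lborel)"
    using c(1) by (subst nn_integral_add) (auto simp: nn_integral_cmult_indicator)
  also have "(\<integral>\<^sup>+u. ?\<psi> u * indicator {c..} u \<partial>lborel) = (\<integral>\<^sup>+t\<in>{c..}. ennreal (C t / t powr r / t) \<partial>lborel)"
    using c(1)
    by (intro nn_integral_cong) (auto simp: indicator_def powr_diff powr_minus field_simps max_def)
  also have "ennreal ?M * ennreal c + (\<integral>\<^sup>+t\<in>{c..}. ennreal (C t / t powr r / t) \<partial>lborel) < \<infinity>"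
    using c(2) by (simp add: ennreal_mult_less_top)
  finally show ?thesis .
qed

text \<open>Tonelli and the substitution u = s g(x): the factor s^(-r-1) ds becomes g(x)^r u^(-r-1)
  du, so the two integrals separate.\<close>

lemma scaled_kernel_integral:
  assumes C: "young_function C" and "0 < r" "0 < \<delta>" and g: "g \<in> borel_measurable lebesgue"
    and nn: "\<And>x. 0 \<le> (g x :: real)"
  shows "(\<integral>\<^sup>+s. (\<integral>\<^sup>+x. ennreal (s powr (- r - 1)) * indicator {0<..} s
      * (ennreal (C (s * g x)) * indicator {\<delta><..} (s * g x)) \<partial>lebesgue) \<partial>lborel)
    = (\<integral>\<^sup>+u. ennreal (u powr (- r - 1) * C (max 0 u)) * indicator {\<delta><..} u \<partial>lborel)
      * (\<integral>\<^sup>+x. ennreal (g x powr r) \<partial>(lebesgue :: ('a::euclidean_space) measure))" (is ?equation)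
    and "(\<lambda>s. \<integral>\<^sup>+x. ennreal (s powr (- r - 1)) * indicator {0<..} s
      * (ennreal (C (s * g x)) * indicator {\<delta><..} (s * g x)) \<partial>lebesgue) \<in> borel_measurable borel" (is ?measurable)
proof -
  define \<psi> where "\<psi> u = ennreal (u powr (- r - 1) * C (max 0 u)) * indicator {\<delta><..} u" for u
  have [measurable]: "(\<lambda>u. C (max 0 u)) \<in> borel_measurable borel"
    by (rule young_function_measurable[OF C])
  have \<psi> [measurable]: "\<psi> \<in> borel_measurable borel" unfolding \<psi>_def by measurable
  \<comment> \<open>Tonelli's theorem is used for the product of two Borel-Lebesgue measures, so g
    is replaced by a Borel function that agrees with it a.e.\<close>
  obtain h where h [measurable]: "h \<in> borel_measurable lborel" and gh: "AE x in lborel. g x = h x"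
    using completion_ex_borel_measurable_real[OF g] by auto
  \<comment> \<open>All dependence on s moves into the single Borel function \<psi> of the product s
    a. Joint measurability is then immediate, and the affine substitution applies.\<close>
  have kernel: "ennreal (s powr (- r - 1)) * indicator {0<..} s * (ennreal (C (s * a)) * indicator {\<delta><..} (s * a))
      = ennreal (a powr (r + 1)) * \<psi> (s * a)" if "0 \<le> a" for s a
  proof (cases "0 < s \<and> \<delta> < s * a")
    case True
    then have "0 < s * a" using \<open>0 < \<delta>\<close> by linarith
    then have "0 < a" using True by (simp add: zero_less_mult_iff)
    have nn: "0 \<le> C (s * a)" using young_function_nonneg[OF C] \<open>0 < s * a\<close> by simp
    have "a powr (r + 1) * (s * a) powr (- r - 1) = s powr (- r - 1)"
      using True \<open>0 < a\<close> by (simp add: powr_mult powr_diff powr_minus powr_add field_simps)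
    then have "s powr (- r - 1) * C (s * a) = a powr (r + 1) * ((s * a) powr (- r - 1) * C (s * a))"
      by (simp add: mult.assoc[symmetric])
    then show ?thesis using True \<open>0 < s * a\<close> nn
      by (simp add: \<psi>_def max_def ennreal_mult[symmetric])
  next
    case False
    then have "\<not> \<delta> < s * a \<or> s \<le> 0" by auto
    moreover have "s * a \<le> 0" if "s \<le> 0" using that \<open>0 \<le> a\<close> by (simp add: mult_nonpos_nonneg)
    ultimately show ?thesis using \<open>0 < \<delta>\<close> by (auto simp: \<psi>_def indicator_def)
  qed
  have inner: "(\<integral>\<^sup>+x. ennreal (s powr (- r - 1)) * indicator {0<..} s
      * (ennreal (C (s * g x)) * indicator {\<delta><..} (s * g x)) \<partial>lebesgue)
    = (\<integral>\<^sup>+x. ennreal (\<bar>h x\<bar> powr (r + 1)) * \<psi> (s * \<bar>h x\<bar>) \<partial>(lborel :: 'a measure))" for s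
  proof -
    have "AE x in lborel. ennreal (g x powr (r + 1)) * \<psi> (s * g x)
        = ennreal (\<bar>h x\<bar> powr (r + 1)) * \<psi> (s * \<bar>h x\<bar>)"
      using gh by eventually_elim (metis abs_of_nonneg nn)
    then show ?thesis
      unfolding kernel[OF nn] nn_integral_completion by (rule nn_integral_cong_AE)
  qed
  show ?measurable unfolding inner by measurable
  have "(\<integral>\<^sup>+s. (\<integral>\<^sup>+x. ennreal (s powr (- r - 1)) * indicator {0<..} s
      * (ennreal (C (s * g x)) * indicator {\<delta><..} (s * g x)) \<partial>lebesgue) \<partial>lborel)
    = (\<integral>\<^sup>+s. (\<integral>\<^sup>+x. ennreal (\<bar>h x\<bar> powr (r + 1)) * \<psi> (s * \<bar>h x\<bar>) \<partial>(lborel :: 'a measure)) \<partial>lborel)"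
    unfolding inner ..
  also have "\<dots> = (\<integral>\<^sup>+x. (\<integral>\<^sup>+s. ennreal (\<bar>h x\<bar> powr (r + 1)) * \<psi> (s * \<bar>h x\<bar>) \<partial>lborel) \<partial>(lborel :: 'a measure))"
    by (rule pair_sigma_finite.Fubini'[OF pair_sigma_finite.intro[OF sigma_finite_lborel sigma_finite_lborel]])
       measurable
  also have "\<dots> = (\<integral>\<^sup>+x. (\<integral>\<^sup>+u. \<psi> u \<partial>lborel) * ennreal (\<bar>h x\<bar> powr r) \<partial>(lborel :: 'a measure))"
  proof (rule nn_integral_cong)
    fix x :: 'a
    define a where "a = \<bar>h x\<bar>"
    have "(\<integral>\<^sup>+s. ennreal (a powr (r + 1)) * \<psi> (s * a) \<partial>lborel) = (\<integral>\<^sup>+u. \<psi> u \<partial>lborel) * ennreal (a powr r)"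
    proof (cases "a = 0")
      case False
      then have "0 < a" by (simp add: a_def)
      have "(\<integral>\<^sup>+s. ennreal (a powr (r + 1)) * \<psi> (s * a) \<partial>lborel)
        = ennreal (a powr r) * (ennreal \<bar>a\<bar> * (\<integral>\<^sup>+s. \<psi> (0 + a * s) \<partial>lborel))"
        using \<open>0 < a\<close> by (subst nn_integral_cmult)
          (auto simp: powr_add ennreal_mult ac_simps)
      also have "ennreal \<bar>a\<bar> * (\<integral>\<^sup>+s. \<psi> (0 + a * s) \<partial>lborel) = (\<integral>\<^sup>+u. \<psi> u \<partial>lborel)"
        by (rule nn_integral_real_affine[symmetric]) (use False in auto)
      finally show ?thesis by (simp add: mult.commute)
    qed simp
    then show "(\<integral>\<^sup>+s. ennreal (\<bar>h x\<bar> powr (r + 1)) * \<psi> (s * \<bar>h x\<bar>) \<partial>lborel)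
        = (\<integral>\<^sup>+u. \<psi> u \<partial>lborel) * ennreal (\<bar>h x\<bar> powr r)"
      by (simp add: a_def)
  qed
  also have "\<dots> = (\<integral>\<^sup>+u. \<psi> u \<partial>lborel) * (\<integral>\<^sup>+x. ennreal (\<bar>h x\<bar> powr r) \<partial>(lborel :: 'a measure))"
    by (rule nn_integral_cmult) measurable
  also have "(\<integral>\<^sup>+x. ennreal (\<bar>h x\<bar> powr r) \<partial>(lborel :: 'a measure)) = (\<integral>\<^sup>+x. ennreal (g x powr r) \<partial>lebesgue)"
    unfolding nn_integral_completion
  proof (rule nn_integral_cong_AE)
    show "AE x in lborel. ennreal (\<bar>h x\<bar> powr r) = ennreal (g x powr r)"
      using gh by eventually_elim (metis abs_of_nonneg nn)
  qed
  finally show ?equation by (simp add: \<psi>_def)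
qed

text \<open>The layer-cake bound turns the sum into an integral over s of the total measure of the
  cubes with norm above 1/s. Sparseness replaces that total by twice the measure of their union, to
  which the weak-type bound applies. K is chosen before S and g, as the passage to infinite families
  requires.\<close>

lemma luxemburg_norm_Carleson:
  assumes C: "young_function C" and "B_condition r C" "0 < r"
  shows "\<exists>K>0. \<forall>(S :: (real ^ 'n) set set) (g :: real ^ 'n \<Rightarrow> 'b::real_normed_vector).
    finite S \<longrightarrow> laminar S \<longrightarrow> (\<forall>Q\<in>S. pos_lmeasurable Q) \<longrightarrow>
    (\<forall>R\<in>S. 2 * emeasure lebesgue (\<Union>{Q\<in>S. Q \<subset> R}) \<le> emeasure lebesgue R) \<longrightarrow>
    g \<in> borel_measurable lebesgue \<longrightarrow>
    (\<Sum>Q\<in>S. emeasure lebesgue Q * ennpowr (luxemburg_norm C Q g) r)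
      \<le> ennreal K * (\<integral>\<^sup>+x. ennreal (norm (g x) powr r) \<partial>lebesgue)"
proof -
  obtain \<delta> where \<delta>: "0 < \<delta>" "C \<delta> \<le> 1 / 2" using young_function_small_value[OF C] .
  let ?J = "\<integral>\<^sup>+u. ennreal (u powr (- r - 1) * C (max 0 u)) * indicator {\<delta><..} u \<partial>lborel"
  obtain J where J: "?J = ennreal J" "0 \<le> J"
    using B_condition_integral_finite[OF C assms(2) \<delta>(1) \<open>0 < r\<close>] by (cases ?J) auto
  \<comment> \<open>The power of 2 comes from the layer-cake bound, 4 = 2 * 2 from sparseness and
    the weak-type bound, and J from the B_r condition. The summand 1 makes K positive.\<close>
  define K where "K = 2 powr (r + 1) * (4 * J) + 1"
  have "0 < K" using J by (simp add: K_def add_nonneg_pos)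
  moreover have "(\<Sum>Q\<in>S. emeasure lebesgue Q * ennpowr (luxemburg_norm C Q g) r)
      \<le> ennreal K * (\<integral>\<^sup>+x. ennreal (norm (g x) powr r) \<partial>lebesgue)"
    if S: "finite S" "laminar S" "\<forall>Q\<in>S. pos_lmeasurable Q"
      "\<forall>R\<in>S. 2 * emeasure lebesgue (\<Union>{Q\<in>S. Q \<subset> R}) \<le> emeasure lebesgue R"
      and g: "g \<in> borel_measurable lebesgue"
    for S :: "(real ^ 'n) set set" and g :: "real ^ 'n \<Rightarrow> 'b"
  proof -
    define W where "W s x = ennreal (C (s * norm (g x))) * indicator {\<delta><..} (s * norm (g x))" for s x
    define k where "k s = ennreal (s powr (- r - 1)) * indicator {0<..} s" for s :: real
    define T where "T s = {Q\<in>S. ennreal (1 / s) < luxemburg_norm C Q g}" for s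
    have Wm: "W s \<in> borel_measurable lebesgue" if "0 < s" for s
    proof -
      have "(\<lambda>x. C (norm (g x) / (1 / s))) \<in> borel_measurable lebesgue"
        using that by (intro young_norm_measurable[OF C _ g]) simp
      then have [measurable]: "(\<lambda>x. C (s * norm (g x))) \<in> borel_measurable lebesgue"
        by (simp add: mult.commute)
      have [measurable]: "(\<lambda>x. s * norm (g x)) \<in> borel_measurable lebesgue" using g by simp
      show ?thesis unfolding W_def by measurable
    qed
    have level: "(\<Sum>Q\<in>T s. emeasure lebesgue Q) \<le> 4 * (\<integral>\<^sup>+x. W s x \<partial>lebesgue)" if "0 < s" for s
    proof -
      have TS: "T s \<subseteq> S" by (auto simp: T_def)
      have "(\<Sum>Q\<in>T s. emeasure lebesgue Q) \<le> 2 * emeasure lebesgue (\<Union>(T s))"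
        using pos_lmeasurableD(1,3) S(3) by (intro sparse_sum_le[OF S(1,2) _ _ _ TS] bspec[OF S(4)]) blast+
      also have "\<dots> \<le> 2 * (2 * (\<integral>\<^sup>+x. ennreal (C (norm (g x) / (1 / s))) *
          indicator {x. \<delta> < norm (g x) / (1 / s)} x \<partial>lebesgue))"
      proof (intro mult_left_mono luxemburg_norm_weak_type[OF C _ _ _ g \<delta>(2)])
        show "finite (T s)" using finite_subset[OF TS S(1)] .
        show "laminar (T s)" using laminar_subset[OF S(2) TS] .
      qed (use S(3) that in \<open>auto simp: T_def\<close>)
      also have "\<dots> = 4 * (\<integral>\<^sup>+x. W s x \<partial>lebesgue)"
        unfolding mult.assoc[symmetric]
        by (intro arg_cong2[where f = "(*)"] nn_integral_cong)
           (auto simp: W_def indicator_def mult.commute)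
      finally show ?thesis .
    qed
    have "(\<Sum>Q\<in>S. emeasure lebesgue Q * ennpowr (luxemburg_norm C Q g) r)
      \<le> (\<Sum>Q\<in>S. emeasure lebesgue Q * (ennreal (2 powr (r + 1)) *
        (\<integral>\<^sup>+s. ennreal (s powr (- r - 1)) * indicator {s. 0 < s \<and> ennreal (1 / s) < luxemburg_norm C Q g} s \<partial>lborel)))"
      by (intro sum_mono mult_left_mono ennpowr_le_layer_cake[OF \<open>0 < r\<close>]) simp
    also have "\<dots> = ennreal (2 powr (r + 1)) * (\<Sum>Q\<in>S. \<integral>\<^sup>+s. emeasure lebesgue Q * (ennreal (s powr (- r - 1)) *
        indicator {s. 0 < s \<and> ennreal (1 / s) < luxemburg_norm C Q g} s) \<partial>lborel)"
      unfolding sum_distrib_left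
      by (intro sum.cong refl, subst nn_integral_cmult) (auto simp: ac_simps)
    also have "\<dots> = ennreal (2 powr (r + 1)) * (\<integral>\<^sup>+s. (\<Sum>Q\<in>S. emeasure lebesgue Q * (ennreal (s powr (- r - 1)) *
        indicator {s. 0 < s \<and> ennreal (1 / s) < luxemburg_norm C Q g} s)) \<partial>lborel)"
      by (subst nn_integral_sum) auto
    also have "\<dots> = ennreal (2 powr (r + 1)) * (\<integral>\<^sup>+s. k s * (\<Sum>Q\<in>T s. emeasure lebesgue Q) \<partial>lborel)"
    proof (intro arg_cong2[where f = "(*)"] refl nn_integral_cong)
      fix s :: real
      have "(\<Sum>Q\<in>T s. emeasure lebesgue Q)
          = (\<Sum>Q\<in>S. if ennreal (1 / s) < luxemburg_norm C Q g then emeasure lebesgue Q else 0)"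
        unfolding T_def using S(1) by (rule sum.inter_filter)
      then show "(\<Sum>Q\<in>S. emeasure lebesgue Q * (ennreal (s powr (- r - 1)) *
        indicator {s. 0 < s \<and> ennreal (1 / s) < luxemburg_norm C Q g} s))
        = k s * (\<Sum>Q\<in>T s. emeasure lebesgue Q)"
        by (auto simp: k_def sum_distrib_left indicator_def mult.commute intro!: sum.cong)
    qed
    also have "\<dots> \<le> ennreal (2 powr (r + 1)) * (\<integral>\<^sup>+s. 4 * (\<integral>\<^sup>+x. k s * W s x \<partial>lebesgue) \<partial>lborel)"
    proof (intro mult_left_mono nn_integral_mono)
      fix s :: real
      show "k s * (\<Sum>Q\<in>T s. emeasure lebesgue Q) \<le> 4 * (\<integral>\<^sup>+x. k s * W s x \<partial>lebesgue)"
      proof (cases "0 < s")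
        case True
        have "k s * (\<Sum>Q\<in>T s. emeasure lebesgue Q) \<le> k s * (4 * (\<integral>\<^sup>+x. W s x \<partial>lebesgue))"
          by (intro mult_left_mono level True) simp
        then show ?thesis using Wm[OF True] by (simp add: nn_integral_cmult mult.left_commute)
      qed (simp add: k_def)
    qed simp
    also have "\<dots> = ennreal (2 powr (r + 1)) * (4 * (\<integral>\<^sup>+s. (\<integral>\<^sup>+x. k s * W s x \<partial>lebesgue) \<partial>lborel))"
      unfolding k_def W_def using g
      by (intro arg_cong2[where f = "(*)"] refl nn_integral_cmult)
         (simp add: scaled_kernel_integral(2)[OF C \<open>0 < r\<close> \<delta>(1)])
    also have "(\<integral>\<^sup>+s. (\<integral>\<^sup>+x. k s * W s x \<partial>lebesgue) \<partial>lborel)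
        = ennreal J * (\<integral>\<^sup>+x. ennreal (norm (g x) powr r) \<partial>lebesgue)"
      unfolding k_def W_def J(1)[symmetric]
      using g by (intro scaled_kernel_integral(1)[OF C \<open>0 < r\<close> \<delta>(1)]) auto
    also have "ennreal (2 powr (r + 1)) * (4 * (ennreal J * (\<integral>\<^sup>+x. ennreal (norm (g x) powr r) \<partial>lebesgue)))
        \<le> ennreal K * (\<integral>\<^sup>+x. ennreal (norm (g x) powr r) \<partial>lebesgue)"
    proof -
      have "ennreal (2 powr (r + 1)) * (4 * ennreal J) = ennreal (2 powr (r + 1) * (4 * J))"
        using J(2) by (simp add: ennreal_mult)
      also have "\<dots> \<le> ennreal K" by (intro ennreal_leI) (simp add: K_def)
      finally show ?thesis unfolding mult.assoc[symmetric] by (rule mult_right_mono) simp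
    qed
    finally show ?thesis .
  qed
  ultimately show ?thesis by blast
qed

section \<open>The estimate for a laminar family\<close>

lemma weighted_arith_geom_mean:
  fixes x :: "'a \<Rightarrow> real"
  assumes "finite I" and \<theta>: "\<And>i. i \<in> I \<Longrightarrow> 0 < \<theta> i" "(\<Sum>i\<in>I. \<theta> i) = 1"
    and x: "\<And>i. i \<in> I \<Longrightarrow> 0 \<le> x i"
  shows "(\<Prod>i\<in>I. x i powr \<theta> i) \<le> (\<Sum>i\<in>I. \<theta> i * x i)"
proof (cases "\<exists>i\<in>I. x i = 0")
  case True
  then have "(\<Prod>i\<in>I. x i powr \<theta> i) = 0" using \<open>finite I\<close> by (intro prod_zero) auto
  also have "\<dots> \<le> (\<Sum>i\<in>I. \<theta> i * x i)"
    using \<theta>(1) x by (intro sum_nonneg mult_nonneg_nonneg) (auto intro: less_imp_le)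
  finally show ?thesis .
next
  case False
  then have pos: "0 < x i" if "i \<in> I" for i using x[OF that] that by (auto simp: less_le)
  have "I \<noteq> {}" using \<theta>(2) by auto
  have "(\<Prod>i\<in>I. x i powr \<theta> i) = exp (\<Sum>i\<in>I. \<theta> i *\<^sub>R ln (x i))"
    using pos \<open>finite I\<close> by (auto simp: exp_sum powr_def less_imp_neq[symmetric] intro!: prod.cong)
  also have "\<dots> \<le> (\<Sum>i\<in>I. \<theta> i * exp (ln (x i)))"
    using \<open>finite I\<close> \<open>I \<noteq> {}\<close> \<theta> by (intro convex_on_sum[OF _ _ exp_convex]) (auto intro: less_imp_le)
  also have "\<dots> = (\<Sum>i\<in>I. \<theta> i * x i)" using pos by (intro sum.cong) auto
  finally show ?thesis .
qed

text \<open>Hoelder's inequality for several factors: after dividing each X i by its weighted sum U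
  i, the inequality between weighted means bounds the left side by the sum of the \<theta> i, which
  is 1. If some U i is 0, every product vanishes.\<close>

lemma sum_prod_powr_le:
  fixes X :: "'i \<Rightarrow> 'a \<Rightarrow> real"
  assumes "finite S" "finite I" and \<theta>: "\<And>i. i \<in> I \<Longrightarrow> 0 < \<theta> i" "(\<Sum>i\<in>I. \<theta> i) = 1"
    and v: "\<And>a. a \<in> S \<Longrightarrow> 0 < v a" and X: "\<And>i a. i \<in> I \<Longrightarrow> a \<in> S \<Longrightarrow> 0 \<le> X i a"
  shows "(\<Sum>a\<in>S. v a * (\<Prod>i\<in>I. X i a powr \<theta> i)) \<le> (\<Prod>i\<in>I. (\<Sum>a\<in>S. v a * X i a) powr \<theta> i)"
proof -
  define U where "U i = (\<Sum>a\<in>S. v a * X i a)" for i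
  have vX: "0 \<le> v a * X i a" if "i \<in> I" "a \<in> S" for i a
    using v[OF that(2)] X[OF that] by simp
  have U: "0 \<le> U i" if "i \<in> I" for i
    unfolding U_def using vX[OF that] by (rule sum_nonneg)
  show ?thesis
  proof (cases "\<exists>i\<in>I. U i = 0")
    case True
    then obtain j where j: "j \<in> I" "U j = 0" by auto
    have "X j a = 0" if "a \<in> S" for a
      using j(2) vX[OF j(1)] v[OF that] that \<open>finite S\<close>
      unfolding U_def by (subst (asm) sum_nonneg_eq_0_iff) auto
    then have "(\<Prod>i\<in>I. X i a powr \<theta> i) = 0" if "a \<in> S" for a
      using that j(1) \<open>finite I\<close> by (intro prod_zero) auto
    then have "(\<Sum>a\<in>S. v a * (\<Prod>i\<in>I. X i a powr \<theta> i)) = 0" by simp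
    also have "\<dots> \<le> (\<Prod>i\<in>I. U i powr \<theta> i)" by (intro prod_nonneg) auto
    finally show ?thesis unfolding U_def .
  next
    case False
    then have pos: "0 < U i" if "i \<in> I" for i using U[OF that] that by (auto simp: less_le)
    have P: "0 < (\<Prod>i\<in>I. U i powr \<theta> i)" using pos by (intro prod_pos) force
    have "(\<Sum>a\<in>S. v a * (\<Prod>i\<in>I. X i a powr \<theta> i))
        = (\<Prod>i\<in>I. U i powr \<theta> i) * (\<Sum>a\<in>S. v a * (\<Prod>i\<in>I. (X i a / U i) powr \<theta> i))"
      unfolding sum_distrib_left
    proof (rule sum.cong[OF refl])
      fix a assume "a \<in> S"
      have "X i a powr \<theta> i = U i powr \<theta> i * (X i a / U i) powr \<theta> i" if "i \<in> I" for i
        using pos[OF that] X[OF that \<open>a \<in> S\<close>] by (simp add: powr_divide)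
      then have "(\<Prod>i\<in>I. X i a powr \<theta> i) = (\<Prod>i\<in>I. U i powr \<theta> i) * (\<Prod>i\<in>I. (X i a / U i) powr \<theta> i)"
        by (simp add: prod.distrib[symmetric])
      then show "v a * (\<Prod>i\<in>I. X i a powr \<theta> i)
          = (\<Prod>i\<in>I. U i powr \<theta> i) * (v a * (\<Prod>i\<in>I. (X i a / U i) powr \<theta> i))" by simp
    qed
    also have "\<dots> \<le> (\<Prod>i\<in>I. U i powr \<theta> i) * (\<Sum>a\<in>S. v a * (\<Sum>i\<in>I. \<theta> i * (X i a / U i)))"
      using \<open>finite I\<close> \<theta> v X U P
      by (intro mult_left_mono sum_mono weighted_arith_geom_mean) (auto intro: less_imp_le)
    also have "(\<Sum>a\<in>S. v a * (\<Sum>i\<in>I. \<theta> i * (X i a / U i))) = (\<Sum>i\<in>I. \<Sum>a\<in>S. \<theta> i / U i * (v a * X i a))"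
      unfolding sum_distrib_left by (subst sum.swap) (simp add: field_simps)
    also have "\<dots> = (\<Sum>i\<in>I. \<theta> i / U i * U i)"
      unfolding U_def sum_distrib_left[symmetric] ..
    also have "\<dots> = 1" using pos \<theta>(2) by (simp add: less_imp_neq[symmetric])
    finally show ?thesis unfolding U_def by simp
  qed
qed

text \<open>One factor of y^s = y y^(s-1) is kept, and in the other y is replaced by the whole
  sum.\<close>

lemma sum_powr_le_powr_sum:
  fixes y :: "'a \<Rightarrow> real"
  assumes "finite S" "\<And>a. a \<in> S \<Longrightarrow> 0 \<le> y a" "1 \<le> s"
  shows "(\<Sum>a\<in>S. y a powr s) \<le> (\<Sum>a\<in>S. y a) powr s"
proof -
  let ?Y = "\<Sum>a\<in>S. y a"
  have Y: "0 \<le> ?Y" using assms(2) by (rule sum_nonneg)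
  have split: "z powr s = z * z powr (s - 1)" if "0 \<le> z" for z
    using that powr_add[of z 1 "s - 1"] by (cases "z = 0") auto
  have "(\<Sum>a\<in>S. y a powr s) = (\<Sum>a\<in>S. y a * y a powr (s - 1))"
    using split assms(2) by (intro sum.cong) auto
  also have "\<dots> \<le> (\<Sum>a\<in>S. y a * ?Y powr (s - 1))"
    using assms by (intro sum_mono mult_left_mono powr_mono2 member_le_sum) auto
  also have "\<dots> = ?Y powr s" unfolding sum_distrib_right[symmetric] split[OF Y] ..
  finally show ?thesis .
qed

text \<open>With weights p / r i, which sum to 1, each term is the power q/p of v times a geometric
  mean of the (X i)^(r i). The embedding of sums for exponent q/p \<ge> 1 and Hoelder's inequality
  then apply. Finite U i and positive v make all X i finite, so the computation takes place in the
  reals.\<close>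

lemma sum_ennpowr_prod_le:
  fixes X :: "'i \<Rightarrow> 'a \<Rightarrow> ennreal"
  assumes S: "finite S" and I: "finite I" and r: "\<And>i. i \<in> I \<Longrightarrow> 0 < r i"
    and p: "0 < p" "1 / p = (\<Sum>i\<in>I. 1 / r i)" "p \<le> q"
    and v: "\<And>a. a \<in> S \<Longrightarrow> 0 < v a"
    and U: "\<And>i. i \<in> I \<Longrightarrow> U i < \<infinity>"
    and le: "\<And>i. i \<in> I \<Longrightarrow> (\<Sum>a\<in>S. ennreal (v a) * ennpowr (X i a) (r i)) \<le> U i"
  shows "(\<Sum>a\<in>S. ennpowr (ennreal (v a powr (1 / p)) * (\<Prod>i\<in>I. X i a)) q)
    \<le> (\<Prod>i\<in>I. ennpowr (U i) (q / r i))"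
proof -
  define x where "x i a = enn2real (X i a)" for i a
  define u where "u i = enn2real (U i)" for i
  have q: "0 < q" using p by simp
  have x0: "0 \<le> x i a" for i a by (simp add: x_def)
  have xX: "X i a = ennreal (x i a)" if "i \<in> I" "a \<in> S" for i a
  proof -
    have "ennreal (v a) * ennpowr (X i a) (r i) \<le> (\<Sum>a\<in>S. ennreal (v a) * ennpowr (X i a) (r i))"
      using S that by (intro member_le_sum) auto
    also have "\<dots> < \<infinity>" using le[OF that(1)] U[OF that(1)] by (rule order.strict_trans1)
    finally have "X i a \<noteq> top" using v[OF that(2)] by (auto simp: ennreal_mult_top)
    then show ?thesis by (simp add: x_def less_top)
  qed
  have uU: "U i = ennreal (u i)" "0 \<le> u i" if "i \<in> I" for i
    using U[OF that] by (auto simp: u_def)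
  have le': "(\<Sum>a\<in>S. v a * x i a powr r i) \<le> u i" if "i \<in> I" for i
  proof -
    have "ennreal (\<Sum>a\<in>S. v a * x i a powr r i) = (\<Sum>a\<in>S. ennreal (v a) * ennpowr (X i a) (r i))"
      using that xX x0 v
      by (subst sum_ennreal[symmetric]) (auto simp: ennreal_mult ennpowr_ennreal less_imp_le intro!: sum.cong)
    also have "\<dots> \<le> ennreal (u i)" using le[OF that] uU[OF that] by simp
    finally show ?thesis using uU(2)[OF that] by simp
  qed
  have \<theta>: "(\<Sum>i\<in>I. p / r i) = 1"
  proof -
    have "(\<Sum>i\<in>I. p / r i) = p * (\<Sum>i\<in>I. 1 / r i)" by (simp add: sum_distrib_left)
    also have "\<dots> = 1" unfolding p(2)[symmetric] using p(1) by simp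
    finally show ?thesis .
  qed
  have summand: "ennpowr (ennreal (v a powr (1 / p)) * (\<Prod>i\<in>I. X i a)) q
      = ennreal ((v a * (\<Prod>i\<in>I. (x i a powr r i) powr (p / r i))) powr (q / p))" if "a \<in> S" for a
  proof -
    have "(\<Prod>i\<in>I. X i a) = ennreal (\<Prod>i\<in>I. x i a)"
      using xX that x0 by (simp add: prod_ennreal)
    then have "ennpowr (ennreal (v a powr (1 / p)) * (\<Prod>i\<in>I. X i a)) q
        = ennreal ((v a powr (1 / p) * (\<Prod>i\<in>I. x i a)) powr q)"
      using x0 by (simp add: ennreal_mult[symmetric] prod_nonneg ennpowr_ennreal)
    also have "(v a powr (1 / p) * (\<Prod>i\<in>I. x i a)) powr q = (v a * (\<Prod>i\<in>I. x i a) powr p) powr (q / p)"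
      using x0 v[OF that] p(1) q by (simp add: powr_mult prod_nonneg powr_powr)
    also have "(\<Prod>i\<in>I. x i a) powr p = (\<Prod>i\<in>I. (x i a powr r i) powr (p / r i))"
      using x0 r by (simp add: prod_powr_distrib powr_powr less_imp_neq[symmetric])
    finally show ?thesis .
  qed
  have "(\<Sum>a\<in>S. ennpowr (ennreal (v a powr (1 / p)) * (\<Prod>i\<in>I. X i a)) q)
      = ennreal (\<Sum>a\<in>S. (v a * (\<Prod>i\<in>I. (x i a powr r i) powr (p / r i))) powr (q / p))"
    using summand by (simp add: sum_ennreal)
  also have "\<dots> \<le> ennreal (\<Prod>i\<in>I. u i powr (q / r i))"
  proof (rule ennreal_leI)
    have "(\<Sum>a\<in>S. (v a * (\<Prod>i\<in>I. (x i a powr r i) powr (p / r i))) powr (q / p))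
        \<le> (\<Sum>a\<in>S. v a * (\<Prod>i\<in>I. (x i a powr r i) powr (p / r i))) powr (q / p)"
      using S v p(1,3) by (intro sum_powr_le_powr_sum mult_nonneg_nonneg prod_nonneg) (auto intro: less_imp_le)
    also have "\<dots> \<le> (\<Prod>i\<in>I. (\<Sum>a\<in>S. v a * x i a powr r i) powr (p / r i)) powr (q / p)"
      using S I \<theta> r p(1) q v
      by (intro powr_mono2 sum_prod_powr_le sum_nonneg mult_nonneg_nonneg prod_nonneg)
         (auto intro: less_imp_le)
    also have "\<dots> \<le> (\<Prod>i\<in>I. u i powr (p / r i)) powr (q / p)"
      using le' r p(1) q v x0
      by (intro powr_mono2 prod_mono conjI sum_nonneg mult_nonneg_nonneg prod_nonneg)
         (auto intro!: less_imp_le)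
    also have "\<dots> = (\<Prod>i\<in>I. u i powr (q / r i))"
      using p(1) by (simp add: prod_powr_distrib powr_powr)
    finally show "(\<Sum>a\<in>S. (v a * (\<Prod>i\<in>I. (x i a powr r i) powr (p / r i))) powr (q / p))
        \<le> (\<Prod>i\<in>I. u i powr (q / r i))" .
  qed
  also have "\<dots> = (\<Prod>i\<in>I. ennpowr (U i) (q / r i))"
    using uU by (simp add: prod_ennreal[symmetric] ennpowr_ennreal)
  finally show ?thesis .
qed

text \<open>\<open>N\<close>, \<open>X\<close>, \<open>Y\<close> stand for the norms of f_i, f_i w_i
  and 1/w_i with respect to B, C_i and A_i, and \<mu> for the integral of \<nu>^q. Since \<mu>^(1/q)
  = (\<mu>/v)^(1/q) v^(1/q) and v^(\<beta> + 1/q) = v^(\<beta> + 1/q - 1/p) v^(1/p), the weight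
  condition absorbs all but v^(1/p) and the \<open>X i\<close>; 2^m collects the m Hoelder
  constants.\<close>

lemma weighted_term_le:
  fixes X Y N :: "nat \<Rightarrow> ennreal"
  assumes "0 < q" "0 < v"
    and le: "\<And>i. i \<in> {1..m} \<Longrightarrow> N i \<le> 2 * (X i * Y i)"
    and K: "ennreal (v powr (\<beta> + 1 / q - 1 / p)) * ennpowr (\<mu> / ennreal v) (1 / q) * (\<Prod>i=1..m. Y i) \<le> K"
  shows "ennpowr (ennreal (v powr \<beta>) * (\<Prod>i=1..m. N i)) q * \<mu>
    \<le> ennpowr (2 ^ m * K) q * ennpowr (ennreal (v powr (1 / p)) * (\<Prod>i=1..m. X i)) q"
proof -
  define A where "A = ennpowr (\<mu> / ennreal v) (1 / q)"
  have \<mu>: "ennpowr (A * ennreal (v powr (1 / q))) q = \<mu>"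
    using assms(1,2)
    by (simp add: A_def ennpowr_mult ennpowr_ennpowr ennpowr_ennreal powr_powr ennreal_divide_times)
  have "ennreal (v powr \<beta>) * (\<Prod>i=1..m. N i) * (A * ennreal (v powr (1 / q)))
      \<le> ennreal (v powr \<beta>) * (\<Prod>i=1..m. 2 * (X i * Y i)) * (A * ennreal (v powr (1 / q)))"
    using le by (intro mult_right_mono mult_left_mono prod_mono_ennreal) auto
  also have "\<dots> = 2 ^ m * ((ennreal (v powr \<beta>) * ennreal (v powr (1 / q))) * A * (\<Prod>i=1..m. Y i)) * (\<Prod>i=1..m. X i)"
    by (simp add: prod.distrib ac_simps)
  also have "ennreal (v powr \<beta>) * ennreal (v powr (1 / q))
      = ennreal (v powr (\<beta> + 1 / q - 1 / p)) * ennreal (v powr (1 / p))"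
    using assms(2) by (simp add: ennreal_mult[symmetric] powr_add[symmetric])
  also have "2 ^ m * (ennreal (v powr (\<beta> + 1 / q - 1 / p)) * ennreal (v powr (1 / p)) * A * (\<Prod>i=1..m. Y i)) * (\<Prod>i=1..m. X i)
      = 2 ^ m * (ennreal (v powr (\<beta> + 1 / q - 1 / p)) * A * (\<Prod>i=1..m. Y i)) * (ennreal (v powr (1 / p)) * (\<Prod>i=1..m. X i))"
    by (simp add: ac_simps)
  also have "\<dots> \<le> 2 ^ m * K * (ennreal (v powr (1 / p)) * (\<Prod>i=1..m. X i))"
    using K unfolding A_def by (intro mult_right_mono mult_left_mono) auto
  finally have "ennpowr (ennreal (v powr \<beta>) * (\<Prod>i=1..m. N i) * (A * ennreal (v powr (1 / q)))) q
      \<le> ennpowr (2 ^ m * K * (ennreal (v powr (1 / p)) * (\<Prod>i=1..m. X i))) q"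
    by (rule ennpowr_mono[OF \<open>0 < q\<close>])
  then show ?thesis
    unfolding ennpowr_mult[OF \<open>0 < q\<close>, of _ "A * _"] ennpowr_mult[OF \<open>0 < q\<close>, of "2 ^ m * K"] \<mu> .
qed

text \<open>The weights enter only through \<open>V\<close>, \<open>D\<close> and \<open>X\<close>,
  and the Carleson embedding only through \<open>U\<close>, so this step is free of the particular
  Young functions A_i and C_i.\<close>

lemma laminar_maximal_estimate:
  fixes F :: "(real ^ 'n) set set" and f :: "nat \<Rightarrow> real ^ 'n \<Rightarrow> 'b::real_normed_vector"
  assumes B: "young_function B"
    and F: "finite F" "laminar F" "\<And>Q. Q \<in> F \<Longrightarrow> pos_lmeasurable Q"
    and f: "\<And>i. i \<in> {1..m} \<Longrightarrow> f i \<in> borel_measurable lebesgue"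
    and "0 \<le> \<beta>" "1 \<le> m"
    and c: "\<And>Q. c Q = ennreal (measure lebesgue Q powr \<beta>) * (\<Prod>i=1..m. luxemburg_norm B Q (f i))"
    and r: "\<And>i. i \<in> {1..m} \<Longrightarrow> 0 < r i"
    and p: "0 < p" "1 / p = (\<Sum>i=1..m. 1 / r i)" "p \<le> q"
    and V: "V \<in> borel_measurable lebesgue"
    and bound: "\<And>Q. Q \<in> F \<Longrightarrow> ennpowr (c Q) q * (\<integral>\<^sup>+x\<in>Q. V x \<partial>lebesgue)
      \<le> D * ennpowr (ennreal (measure lebesgue Q powr (1 / p)) * (\<Prod>i=1..m. X i Q)) q"
    and U: "\<And>i. i \<in> {1..m} \<Longrightarrow> U i < \<infinity>"
    and Carleson: "\<And>i S. i \<in> {1..m} \<Longrightarrow> finite S \<Longrightarrow> laminar S \<Longrightarrow> \<forall>Q\<in>S. pos_lmeasurable Q \<Longrightarrow>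
      \<forall>R\<in>S. 2 * emeasure lebesgue (\<Union>{Q\<in>S. Q \<subset> R}) \<le> emeasure lebesgue R \<Longrightarrow>
      (\<Sum>Q\<in>S. emeasure lebesgue Q * ennpowr (X i Q) (r i)) \<le> U i"
  shows "(\<integral>\<^sup>+x. (SUP Q\<in>F. ennpowr (c Q) q * indicator Q x) * V x \<partial>lebesgue)
    \<le> ennpowr (ennreal ((4 * real m) ^ m)) q * D * (\<Prod>i=1..m. ennpowr (U i) (q / r i))"
proof -
  define a where "a = ennreal ((4 * real m) ^ m)"
  have "0 < q" using p by simp
  have "1 \<le> (4 * real m) ^ m" using \<open>1 \<le> m\<close> by (intro one_le_power) simp
  then have a1: "1 \<le> a" unfolding a_def by (metis ennreal_1 ennreal_leI)
  obtain S where S: "S \<subseteq> F" "\<forall>Q\<in>F. Q \<in> S \<longleftrightarrow> (\<forall>R\<in>S. Q \<subset> R \<longrightarrow> a * c R < c Q)"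
    using stopping_family_exists[OF F(1), of "\<lambda>Q R. a * c R < c Q"] by blast
  have finS: "finite S" by (rule finite_subset[OF S(1) F(1)])
  have lamS: "laminar S" by (rule laminar_subset[OF F(2) S(1)])
  have posS: "\<forall>Q\<in>S. pos_lmeasurable Q" using S(1) F(3) by blast
  have sparse: "\<forall>R\<in>S. 2 * emeasure lebesgue (\<Union>{Q\<in>S. Q \<subset> R}) \<le> emeasure lebesgue R"
    using stopping_family_sparse[OF B F f \<open>0 \<le> \<beta>\<close> \<open>1 \<le> m\<close> c S(1)] S(2) unfolding a_def by blast
  \<comment> \<open>A set that is not kept was blocked by a larger kept R with c Q \<le> a c R; a
    kept set serves as its own R because a \<ge> 1. The supremum is thus at most a sum over kept
    sets.\<close>
  have principal: "\<exists>R\<in>S. Q \<subseteq> R \<and> c Q \<le> a * c R" if "Q \<in> F" for Q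
  proof (cases "Q \<in> S")
    case True
    have "1 * c Q \<le> a * c Q" using a1 by (rule mult_right_mono) simp
    then show ?thesis using True by auto
  next
    case False
    then obtain R where "R \<in> S" "Q \<subset> R" "\<not> a * c R < c Q" using bspec[OF S(2) \<open>Q \<in> F\<close>] by auto
    then show ?thesis by (auto simp: not_less)
  qed
  have "(\<integral>\<^sup>+x. (SUP Q\<in>F. ennpowr (c Q) q * indicator Q x) * V x \<partial>lebesgue)
      \<le> (\<integral>\<^sup>+x. (\<Sum>R\<in>S. ennpowr (a * c R) q * (V x * indicator R x)) \<partial>lebesgue)"
  proof (rule nn_integral_mono)
    fix x
    have "(SUP Q\<in>F. ennpowr (c Q) q * indicator Q x) \<le> (\<Sum>R\<in>S. ennpowr (a * c R) q * indicator R x)"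
    proof (rule SUP_least)
      fix Q assume "Q \<in> F"
      then obtain R where R: "R \<in> S" "Q \<subseteq> R" "c Q \<le> a * c R" using principal by blast
      have "ennpowr (c Q) q * indicator Q x \<le> ennpowr (a * c R) q * indicator R x"
        using R \<open>0 < q\<close> by (intro mult_mono ennpowr_mono) (auto simp: indicator_def)
      also have "\<dots> \<le> (\<Sum>R\<in>S. ennpowr (a * c R) q * indicator R x)"
        using R(1) finS by (intro member_le_sum) auto
      finally show "ennpowr (c Q) q * indicator Q x \<le> (\<Sum>R\<in>S. ennpowr (a * c R) q * indicator R x)" .
    qed
    then have "(SUP Q\<in>F. ennpowr (c Q) q * indicator Q x) * V x
        \<le> (\<Sum>R\<in>S. ennpowr (a * c R) q * indicator R x) * V x"
      by (rule mult_right_mono) simp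
    then show "(SUP Q\<in>F. ennpowr (c Q) q * indicator Q x) * V x
        \<le> (\<Sum>R\<in>S. ennpowr (a * c R) q * (V x * indicator R x))"
      by (simp add: sum_distrib_left sum_distrib_right ac_simps)
  qed
  also have "\<dots> = (\<Sum>R\<in>S. ennpowr (a * c R) q * (\<integral>\<^sup>+x\<in>R. V x \<partial>lebesgue))"
  proof -
    have VR: "(\<lambda>x. V x * indicator R x) \<in> borel_measurable lebesgue" if "R \<in> S" for R
      using posS that pos_lmeasurableD(1)
      by (intro borel_measurable_times_ennreal[OF V] borel_measurable_indicator) blast
    then show ?thesis by (subst nn_integral_sum) (auto simp: nn_integral_cmult)
  qed
  also have "\<dots> \<le> (\<Sum>R\<in>S. ennpowr a q * (D * ennpowr (ennreal (measure lebesgue R powr (1 / p)) * (\<Prod>i=1..m. X i R)) q))"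
    unfolding ennpowr_mult[OF \<open>0 < q\<close>, of a] mult.assoc
    using S(1) bound by (intro sum_mono mult_left_mono) auto
  also have "\<dots> = ennpowr a q * D * (\<Sum>R\<in>S. ennpowr (ennreal (measure lebesgue R powr (1 / p)) * (\<Prod>i=1..m. X i R)) q)"
    by (simp add: sum_distrib_left mult.assoc)
  also have "\<dots> \<le> ennpowr a q * D * (\<Prod>i=1..m. ennpowr (U i) (q / r i))"
  proof (intro mult_left_mono sum_ennpowr_prod_le finS r p U)
    fix i assume i: "i \<in> {1..m}"
    have "(\<Sum>Q\<in>S. ennreal (measure lebesgue Q) * ennpowr (X i Q) (r i))
        = (\<Sum>Q\<in>S. emeasure lebesgue Q * ennpowr (X i Q) (r i))"
      using posS by (intro sum.cong refl arg_cong2[where f = "(*)"] pos_lmeasurableD(4)[symmetric]) blast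
    then show "(\<Sum>Q\<in>S. ennreal (measure lebesgue Q) * ennpowr (X i Q) (r i)) \<le> U i"
      using Carleson[OF i finS lamS posS sparse] by simp
  qed (use posS pos_lmeasurableD(5) in auto)
  finally show ?thesis unfolding a_def .
qed

text \<open>The finite bound does not depend on the family, so monotone convergence along initial
  segments of an enumeration gives it for F. Measurability is recorded because the integrals for the
  different grids are later added.\<close>

lemma countable_laminar_maximal_estimate:
  fixes F :: "(real ^ 'n) set set" and f :: "nat \<Rightarrow> real ^ 'n \<Rightarrow> 'b::real_normed_vector"
  assumes B: "young_function B"
    and F: "countable F" "laminar F" "\<And>Q. Q \<in> F \<Longrightarrow> pos_lmeasurable Q"
    and f: "\<And>i. i \<in> {1..m} \<Longrightarrow> f i \<in> borel_measurable lebesgue"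
    and "0 \<le> \<beta>" "1 \<le> m"
    and c: "\<And>Q. c Q = ennreal (measure lebesgue Q powr \<beta>) * (\<Prod>i=1..m. luxemburg_norm B Q (f i))"
    and r: "\<And>i. i \<in> {1..m} \<Longrightarrow> 0 < r i"
    and p: "0 < p" "1 / p = (\<Sum>i=1..m. 1 / r i)" "p \<le> q"
    and V: "V \<in> borel_measurable lebesgue"
    and bound: "\<And>Q. Q \<in> F \<Longrightarrow> ennpowr (c Q) q * (\<integral>\<^sup>+x\<in>Q. V x \<partial>lebesgue)
      \<le> D * ennpowr (ennreal (measure lebesgue Q powr (1 / p)) * (\<Prod>i=1..m. X i Q)) q"
    and U: "\<And>i. i \<in> {1..m} \<Longrightarrow> U i < \<infinity>"
    and Carleson: "\<And>i S. i \<in> {1..m} \<Longrightarrow> finite S \<Longrightarrow> laminar S \<Longrightarrow> \<forall>Q\<in>S. pos_lmeasurable Q \<Longrightarrow>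
      \<forall>R\<in>S. 2 * emeasure lebesgue (\<Union>{Q\<in>S. Q \<subset> R}) \<le> emeasure lebesgue R \<Longrightarrow>
      (\<Sum>Q\<in>S. emeasure lebesgue Q * ennpowr (X i Q) (r i)) \<le> U i"
  shows "(\<lambda>x. (SUP Q\<in>F. ennpowr (c Q) q * indicator Q x) * V x) \<in> borel_measurable lebesgue"
    and "(\<integral>\<^sup>+x. (SUP Q\<in>F. ennpowr (c Q) q * indicator Q x) * V x \<partial>lebesgue)
    \<le> ennpowr (ennreal ((4 * real m) ^ m)) q * D * (\<Prod>i=1..m. ennpowr (U i) (q / r i))"
proof -
  define G where "G N = from_nat_into F ` {..<N}" for N :: nat
  let ?h = "\<lambda>G x. (SUP Q\<in>G. ennpowr (c Q) q * indicator Q x) * V x"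
  have meas: "?h G \<in> borel_measurable lebesgue" if "countable G" "G \<subseteq> F" for G
    using that V pos_lmeasurableD(1)[OF F(3)]
    by (intro borel_measurable_times_ennreal borel_measurable_SUP borel_measurable_indicator) auto
  show "?h F \<in> borel_measurable lebesgue" using meas F(1) by simp
  show "(\<integral>\<^sup>+x. ?h F x \<partial>lebesgue)
    \<le> ennpowr (ennreal ((4 * real m) ^ m)) q * D * (\<Prod>i=1..m. ennpowr (U i) (q / r i))"
  proof (cases "F = {}")
    case False
    have GF: "G N \<subseteq> F" for N using from_nat_into[OF False] by (auto simp: G_def)
    have finG: "finite (G N)" for N by (simp add: G_def)
    have UG: "(\<Union>N. G N) = F"
      unfolding G_def image_UN[symmetric] UN_lessThan_UNIV by (rule range_from_nat_into[OF False F(1)])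
    have "(SUP Q\<in>F. ennpowr (c Q) q * indicator Q x)
        = (SUP N. SUP Q\<in>G N. ennpowr (c Q) q * indicator Q x)" for x
      unfolding UG[symmetric] by (rule SUP_UNION)
    then have "(\<integral>\<^sup>+x. ?h F x \<partial>lebesgue) = (\<integral>\<^sup>+x. (SUP N. ?h (G N) x) \<partial>lebesgue)"
      by (simp add: SUP_mult_right_ennreal)
    also have "\<dots> = (SUP N. \<integral>\<^sup>+x. ?h (G N) x \<partial>lebesgue)"
    proof (rule nn_integral_monotone_convergence_SUP)
      show "incseq (\<lambda>N. ?h (G N))"
        unfolding incseq_def le_fun_def G_def
        by (intro allI impI mult_right_mono SUP_subset_mono) auto
      show "?h (G N) \<in> borel_measurable lebesgue" for N
        using finG GF by (intro meas countable_finite)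
    qed
    also have "\<dots> \<le> ennpowr (ennreal ((4 * real m) ^ m)) q * D * (\<Prod>i=1..m. ennpowr (U i) (q / r i))"
    proof (rule SUP_least)
      fix N
      show "(\<integral>\<^sup>+x. ?h (G N) x \<partial>lebesgue)
        \<le> ennpowr (ennreal ((4 * real m) ^ m)) q * D * (\<Prod>i=1..m. ennpowr (U i) (q / r i))"
      proof (rule laminar_maximal_estimate[OF B finG _ _ f \<open>0 \<le> \<beta>\<close> \<open>1 \<le> m\<close> c r p V _ U Carleson])
        show "laminar (G N)" by (rule laminar_subset[OF F(2) GF])
        fix Q assume "Q \<in> G N"
        then have "Q \<in> F" using GF by blast
        then show "pos_lmeasurable Q" and "ennpowr (c Q) q * (\<integral>\<^sup>+x\<in>Q. V x \<partial>lebesgue)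
          \<le> D * ennpowr (ennreal (measure lebesgue Q powr (1 / p)) * (\<Prod>i=1..m. X i Q)) q"
          by (rule F(3), rule bound)
      qed
    qed
    finally show ?thesis .
  qed (simp add: bot_ennreal)
qed

section \<open>Shifted dyadic grids\<close>

text \<open>Left endpoint of the j-th interval of length 2^k, in the standard grid or in the one
  shifted by a third of a step. The sign of the shift alternates with k because doubling 1/3 gives
  -1/3 modulo 1; this is what makes every endpoint at scale k + 1 an endpoint at scale k.\<close>

definition shifted_point :: "bool \<Rightarrow> int \<Rightarrow> int \<Rightarrow> real" where
  "shifted_point t k j = 2 powr k * (j + (if t then (if even k then 1 else - 1) / 3 else 0))"

lemma shifted_point_add_1: "shifted_point t k (j + 1) = shifted_point t k j + 2 powr k"
  by (simp add: shifted_point_def algebra_simps)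

lemma shifted_point_coarser_1:
  "shifted_point t (k + 1) j = shifted_point t k (2 * j - (if t then (if even k then 1 else - 1) else 0))"
  by (simp add: shifted_point_def powr_add field_simps)

lemma shifted_point_coarser:
  assumes "k \<le> l"
  shows "\<exists>j'. shifted_point t l j = shifted_point t k j'"
  using assms
proof (induction l arbitrary: j rule: int_ge_induct)
  case (step i)
  then show ?case by (metis shifted_point_coarser_1)
qed auto

lemma shifted_point_separated:
  assumes "shifted_point t k i < shifted_point t k j"
  shows "shifted_point t k i + 2 powr k \<le> shifted_point t k j"
proof -
  have "i < j" using assms by (simp add: shifted_point_def)
  then have "real_of_int i + 1 \<le> j" by simp
  then have "2 powr k * (real_of_int i + 1) \<le> 2 powr k * j" by (intro mult_left_mono) auto
  then show ?thesis by (simp add: shifted_point_def algebra_simps)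
qed

text \<open>The one-third trick: the two grids of step \<open>2 ^ k\<close> are \<open>2 ^ k / 3\<close> apart, so a shorter interval
  cannot meet both.\<close>
lemma interval_in_shifted_grid:
  assumes "0 < l" "3 * l < 2 powr (k :: int)"
  shows "\<exists>t j. shifted_point t k j \<le> a \<and> a + l < shifted_point t k j + 2 powr k"
proof (rule ccontr)
  assume no: "\<not> ?thesis"
  \<comment> \<open>The cell that contains a must end at or before a + l, since otherwise it would
    contain the whole interval. Its right end is the point sought.\<close>
  have pt: "\<exists>j. a < shifted_point t k j \<and> shifted_point t k j \<le> a + l" for t
  proof -
    define s where "s = (if t then (if even k then 1 else - 1) / 3 else 0 :: real)"
    define j where "j = \<lfloor>a / 2 powr k - s\<rfloor>"
    have "j \<le> a / 2 powr k - s" "a / 2 powr k - s < j + 1" unfolding j_def by linarith+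
    then have "shifted_point t k j \<le> a" "a < shifted_point t k (j + 1)"
      by (auto simp: shifted_point_def s_def[symmetric] field_simps)
    then show ?thesis using no shifted_point_add_1[of t k j] by (metis not_less)
  qed
  obtain i j where ij: "a < shifted_point False k i" "shifted_point False k i \<le> a + l"
    "a < shifted_point True k j" "shifted_point True k j \<le> a + l" using pt by metis
  define e where "e = (if even k then 1 else - 1 :: int)"
  \<comment> \<open>d is three times the distance of the two grid points in units of 2^k. It is an
    integer congruent to 1 or -1 modulo 3, yet the points lie so close together that |d| <
    1.\<close>
  define d where "d = 3 * (j - i) + e"
  have "real_of_int d = 3 * (shifted_point True k j - shifted_point False k i) / 2 powr k"
    by (simp add: shifted_point_def d_def e_def field_simps)
  moreover have "3 * (shifted_point True k j - shifted_point False k i) < 2 powr k"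
    "- (2 powr k) < 3 * (shifted_point True k j - shifted_point False k i)"
    using ij assms by auto
  ultimately have "real_of_int d < 1" "- 1 < real_of_int d"
    by (simp_all add: pos_divide_less_eq pos_less_divide_eq)
  then have "d = 0" by linarith
  then show False unfolding d_def e_def by presburger
qed

text \<open>The shift t is chosen separately in each coordinate, which gives 2^n grids.\<close>

definition dyadic_box :: "('n \<Rightarrow> bool) \<Rightarrow> int \<Rightarrow> ('n \<Rightarrow> int) \<Rightarrow> (real ^ 'n) set" where
  "dyadic_box t k j = {x. \<forall>i. shifted_point (t i) k (j i) \<le> x $ i \<and> x $ i < shifted_point (t i) k (j i) + 2 powr k}"

definition dyadic_grid :: "('n \<Rightarrow> bool) \<Rightarrow> (real ^ 'n) set set" where
  "dyadic_grid t = (\<Union>k. range (dyadic_box t k))"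

lemma countable_dyadic_grid: "countable (dyadic_grid (t :: 'n::finite \<Rightarrow> bool))"
  by (simp add: dyadic_grid_def)

text \<open>In each coordinate both ends of the coarser cell are grid points of the finer scale, and
  a cell never straddles a grid point of its own scale.\<close>

lemma dyadic_box_nested:
  assumes "k \<le> l" "dyadic_box t k i \<inter> dyadic_box t l j \<noteq> {}"
  shows "dyadic_box t k i \<subseteq> dyadic_box t l j"
proof -
  obtain x where x: "x \<in> dyadic_box t k i" "x \<in> dyadic_box t l j" using assms(2) by auto
  have "shifted_point (t a) l (j a) \<le> shifted_point (t a) k (i a) \<and>
    shifted_point (t a) k (i a) + 2 powr k \<le> shifted_point (t a) l (j a) + 2 powr l" for a
  proof -
    let ?P = "shifted_point (t a) k (i a)" and ?R = "shifted_point (t a) l (j a)"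
    obtain b where b: "?R = shifted_point (t a) k b" using shifted_point_coarser[OF assms(1)] by blast
    obtain b' where b': "?R + 2 powr l = shifted_point (t a) k b'"
      unfolding shifted_point_add_1[symmetric] using shifted_point_coarser[OF assms(1)] by blast
    have "?P \<le> x $ a" "x $ a < ?P + 2 powr k" "?R \<le> x $ a" "x $ a < ?R + 2 powr l"
      using x by (auto simp: dyadic_box_def)
    then have "shifted_point (t a) k b < shifted_point (t a) k (i a + 1)" "?P < shifted_point (t a) k b'"
      unfolding b[symmetric] b'[symmetric] by (auto simp: shifted_point_add_1)
    then have "shifted_point (t a) k b + 2 powr k \<le> shifted_point (t a) k (i a + 1)"
      "?P + 2 powr k \<le> shifted_point (t a) k b'"
      by (auto intro: shifted_point_separated)
    then show ?thesis unfolding b[symmetric] b'[symmetric] by (simp add: shifted_point_add_1)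
  qed
  then show ?thesis unfolding dyadic_box_def by (auto intro: order_trans order_less_le_trans)
qed

lemma laminar_dyadic_grid: "laminar (dyadic_grid t)"
  unfolding laminar_def
proof (intro ballI)
  fix Q R assume "Q \<in> dyadic_grid t" "R \<in> dyadic_grid t"
  then obtain k i l j where "Q = dyadic_box t k i" "R = dyadic_box t l j"
    by (auto simp: dyadic_grid_def)
  then show "Q \<subseteq> R \<or> R \<subseteq> Q \<or> Q \<inter> R = {}"
    using dyadic_box_nested[of k l t i j] dyadic_box_nested[of l k t j i] by (metis inf_commute linear)
qed

text \<open>The box lies between an open cube and its closure, whose difference is null.
  Completeness of Lebesgue measure also yields measurability of the box.\<close>

lemma dyadic_box_AE_cube:
  fixes t :: "'n::finite \<Rightarrow> bool"
  obtains a :: "real ^ 'n" where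
    "AE x in lebesgue. x \<in> dyadic_box t k j \<longleftrightarrow> x \<in> cbox a (\<chi> i. a $ i + 2 powr k)"
    "dyadic_box t k j \<in> sets lebesgue"
proof -
  define a :: "real ^ 'n" where "a = (\<chi> i. shifted_point (t i) k (j i))"
  let ?b = "\<chi> i. a $ i + 2 powr k"
  have sub: "box a ?b \<subseteq> dyadic_box t k j" "dyadic_box t k j \<subseteq> cbox a ?b"
    by (auto simp: dyadic_box_def mem_box_cart a_def less_imp_le)
  have null: "cbox a ?b - box a ?b \<in> null_sets lebesgue"
    using negligible_frontier_interval negligible_iff_null_sets by blast
  have "AE x in lebesgue. x \<in> dyadic_box t k j \<longleftrightarrow> x \<in> cbox a ?b"
    using sub by (intro AE_I'[OF null]) auto
  moreover have "dyadic_box t k j \<in> sets lebesgue"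
  proof -
    have "dyadic_box t k j \<inter> (cbox a ?b - box a ?b) \<in> sets lebesgue"
      by (rule null_setsD2[OF null_sets_completion_subset[OF _ null]]) auto
    then have "box a ?b \<union> (dyadic_box t k j \<inter> (cbox a ?b - box a ?b)) \<in> sets lebesgue"
      by (intro sets.Un) auto
    also have "box a ?b \<union> (dyadic_box t k j \<inter> (cbox a ?b - box a ?b)) = dyadic_box t k j"
      using sub by blast
    finally show ?thesis .
  qed
  ultimately show ?thesis by (rule that)
qed

section \<open>Comparison of cubes with grid boxes\<close>

lemma measure_cube:
  fixes a :: "real ^ 'n"
  assumes "0 < l"
  shows "measure lebesgue (cbox a (\<chi> i. a $ i + l)) = l ^ CARD('n)"
proof -
  have "cbox a (\<chi> i. a $ i + l) \<noteq> {}"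
    using assms by (simp add: interval_ne_empty_cart less_imp_le)
  then show ?thesis by (simp add: content_cbox_cart)
qed

lemma pos_lmeasurable_cube:
  assumes "Q \<in> cubes"
  shows "pos_lmeasurable Q"
proof -
  obtain a l where Q: "Q = cbox a (\<chi> i. a $ i + l)" "0 < l" using assms by (auto simp: cubes_def)
  have "emeasure lebesgue Q = ennreal (measure lebesgue Q)"
    unfolding Q(1) by (intro emeasure_eq_measure2 lmeasurable_cbox)
  then show ?thesis using measure_cube[OF Q(2), of a] Q by (simp add: pos_lmeasurable_def)
qed

lemma dyadic_grid_cube:
  assumes "D \<in> dyadic_grid t"
  obtains Q where "Q \<in> cubes" "AE x in lebesgue. x \<in> D \<longleftrightarrow> x \<in> Q" "D \<in> sets lebesgue"
    "emeasure lebesgue D = emeasure lebesgue Q"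
proof -
  obtain k j where D: "D = dyadic_box t k j" using assms by (auto simp: dyadic_grid_def)
  obtain a where a: "AE x in lebesgue. x \<in> D \<longleftrightarrow> x \<in> cbox a (\<chi> i. a $ i + 2 powr k)" "D \<in> sets lebesgue"
    unfolding D by (rule dyadic_box_AE_cube)
  show ?thesis
  proof (rule that[OF _ a])
    show "cbox a (\<chi> i. a $ i + 2 powr k) \<in> cubes"
      unfolding cubes_def by (intro CollectI exI[of _ a] exI[of _ "2 powr k"]) simp
    show "emeasure lebesgue D = emeasure lebesgue (cbox a (\<chi> i. a $ i + 2 powr k))"
      using a by (intro emeasure_eq_AE) auto
  qed
qed

lemma pos_lmeasurable_dyadic_grid:
  assumes "D \<in> dyadic_grid t"
  shows "pos_lmeasurable D"
proof (rule dyadic_grid_cube[OF assms])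
  fix Q assume Q: "Q \<in> cubes" "D \<in> sets lebesgue" "emeasure lebesgue D = emeasure lebesgue Q"
  from pos_lmeasurable_cube[OF Q(1)] Q(2,3) show ?thesis by (simp only: pos_lmeasurable_def)
qed

lemma nn_integral_eq_AE_set:
  assumes "AE x in M. x \<in> D \<longleftrightarrow> x \<in> Q"
  shows "(\<integral>\<^sup>+x\<in>D. f x \<partial>M) = (\<integral>\<^sup>+x\<in>Q. f x \<partial>M)"
  using assms by (intro nn_integral_cong_AE) (auto simp: indicator_def elim: eventually_mono)

lemma luxemburg_norm_eq_AE_set:
  assumes "AE x in lebesgue. x \<in> D \<longleftrightarrow> x \<in> Q" "emeasure lebesgue D = emeasure lebesgue Q"
  shows "luxemburg_norm B D f = luxemburg_norm B Q f"
  unfolding luxemburg_norm_def nn_integral_eq_AE_set[OF assms(1)] assms(2) ..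

lemma cube_in_dyadic_grid:
  fixes Q :: "(real ^ 'n) set"
  assumes "Q \<in> cubes"
  obtains t D where "D \<in> dyadic_grid t" "Q \<subseteq> D"
    "emeasure lebesgue D \<le> ennreal (6 ^ CARD('n)) * emeasure lebesgue Q"
proof -
  obtain a l where Q: "Q = cbox a (\<chi> i. a $ i + l)" and l: "0 < l"
    using assms by (auto simp: cubes_def)
  \<comment> \<open>The least integer with 2^k > 3 l. Minimality gives 2^k \<le> 6 l, the origin of
    the factor 6^n.\<close>
  define k where "k = \<lfloor>log 2 (3 * l)\<rfloor> + 1"
  have "log 2 (3 * l) < k" "k \<le> log 2 (3 * l) + 1" unfolding k_def by linarith+
  then have "2 powr (log 2 (3 * l)) < 2 powr k" "2 powr k \<le> 2 powr (log 2 (3 * l) + 1)" by auto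
  then have k: "3 * l < 2 powr k" "2 powr k \<le> 6 * l" using l by (auto simp: powr_add)
  have "\<forall>i. \<exists>t j. shifted_point t k j \<le> a $ i \<and> a $ i + l < shifted_point t k j + 2 powr k"
    using interval_in_shifted_grid[OF l k(1)] by blast
  then obtain t j where tj: "\<And>i. shifted_point (t i) k (j i) \<le> a $ i"
    "\<And>i. a $ i + l < shifted_point (t i) k (j i) + 2 powr k" by metis
  have sub: "Q \<subseteq> dyadic_box t k j"
    unfolding Q dyadic_box_def
    using order_trans[OF tj(1)] order_le_less_trans[OF _ tj(2)] by (auto simp: mem_box_cart)
  obtain b where b: "AE x in lebesgue. x \<in> dyadic_box t k j \<longleftrightarrow> x \<in> cbox b (\<chi> i. b $ i + 2 powr k)"
    "dyadic_box t k j \<in> sets lebesgue" by (rule dyadic_box_AE_cube)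
  have "emeasure lebesgue (dyadic_box t k j) = emeasure lebesgue (cbox b (\<chi> i. b $ i + 2 powr k))"
    using b by (intro emeasure_eq_AE) auto
  also have "\<dots> = ennreal ((2 powr k) ^ CARD('n))"
    using measure_cube[of "2 powr k" b] by (subst emeasure_eq_measure2[OF lmeasurable_cbox]) simp
  also have "\<dots> \<le> ennreal ((6 * l) ^ CARD('n))"
    using k(2) by (intro ennreal_leI power_mono) auto
  also have "\<dots> = ennreal (6 ^ CARD('n)) * emeasure lebesgue Q"
    using measure_cube[OF l, of a] l unfolding Q
    by (subst emeasure_eq_measure2[OF lmeasurable_cbox]) (simp add: power_mult_distrib ennreal_mult)
  finally show ?thesis using that[OF _ sub] by (auto simp: dyadic_grid_def)
qed

text \<open>Passing from Q to a grid box D costs 6^n in each of the m norms, while the power of the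
  measure can only grow since \<alpha> \<ge> 0. A sum over the finitely many grids replaces their
  maximum so that it can be integrated term by term.\<close>

lemma multi_maximal_dyadic_le:
  fixes f :: "nat \<Rightarrow> real ^ 'n \<Rightarrow> 'b::real_normed_vector"
  assumes B: "young_function B" and "0 \<le> \<alpha>" "0 < q"
    and f: "\<And>i. i \<in> {1..m} \<Longrightarrow> f i \<in> borel_measurable lebesgue"
    and c: "\<And>Q. c Q = ennreal (measure lebesgue Q powr (\<alpha> / real CARD('n))) * (\<Prod>i=1..m. luxemburg_norm B Q (f i))"
    and V: "V x = ennreal (y powr q)" "0 \<le> y"
  shows "ennpowr (multi_maximal \<alpha> B m f x * ennreal y) q
    \<le> ennpowr (ennreal ((6 ^ CARD('n)) ^ m)) q *
      (\<Sum>t\<in>UNIV. (SUP D\<in>dyadic_grid t. ennpowr (c D) q * indicator D x) * V x)"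
proof -
  let ?M = "ennreal ((6 ^ CARD('n)) ^ m)"
  let ?h = "\<lambda>t. (SUP D\<in>dyadic_grid t. ennpowr (c D) q * indicator D x) * V x"
  have "multi_maximal \<alpha> B m f x * ennreal y \<le> ennpowr (ennpowr ?M q * (\<Sum>t\<in>UNIV. ?h t)) (1 / q)"
    unfolding multi_maximal_def
  proof (subst SUP_mult_right_ennreal, rule SUP_least)
    fix Q assume "Q \<in> {Q \<in> cubes. x \<in> Q}"
    then have Q: "Q \<in> cubes" "x \<in> Q" by auto
    obtain t D where D: "D \<in> dyadic_grid t" "Q \<subseteq> D"
      "emeasure lebesgue D \<le> ennreal (6 ^ CARD('n)) * emeasure lebesgue Q"
      using cube_in_dyadic_grid[OF Q(1)] .
    note Qm = pos_lmeasurable_cube[OF Q(1)] and Dm = pos_lmeasurable_dyadic_grid[OF D(1)]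
    have "measure lebesgue Q \<le> measure lebesgue D"
      using D(2) pos_lmeasurableD[OF Qm] pos_lmeasurableD[OF Dm]
      by (intro measure_mono_fmeasurable) (auto simp: fmeasurable_def)
    then have "c Q \<le> ennreal (measure lebesgue D powr (\<alpha> / real CARD('n))) *
        (\<Prod>i=1..m. ennreal (6 ^ CARD('n)) * luxemburg_norm B D (f i))"
      unfolding c using \<open>0 \<le> \<alpha>\<close> f D
      by (intro mult_mono prod_mono_ennreal ennreal_leI powr_mono2 luxemburg_norm_superset[OF B Qm Dm])
         auto
    also have "\<dots> = ?M * c D"
      unfolding c prod.distrib by (simp add: ennreal_power ac_simps)
    finally have "ennpowr (c Q * ennreal y) q \<le> ennpowr (?M * c D * ennreal y) q"
      using \<open>0 < q\<close> by (intro ennpowr_mono mult_right_mono) auto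
    also have "\<dots> = ennpowr ?M q * (ennpowr (c D) q * indicator D x * V x)"
      using \<open>0 < q\<close> Q(2) D(2) V by (simp add: ennpowr_mult ennpowr_ennreal subset_iff mult.assoc)
    also have "\<dots> \<le> ennpowr ?M q * ?h t"
      using D(1) by (intro mult_left_mono mult_right_mono SUP_upper) auto
    also have "\<dots> \<le> ennpowr ?M q * (\<Sum>t\<in>UNIV. ?h t)"
      by (intro mult_left_mono member_le_sum) auto
    finally have "c Q * ennreal y \<le> ennpowr (ennpowr ?M q * (\<Sum>t\<in>UNIV. ?h t)) (1 / q)"
      by (rule iffD1[OF ennpowr_le_iff[OF \<open>0 < q\<close>]])
    then show "ennreal (measure lebesgue Q powr (\<alpha> / real CARD('n))) *
        (\<Prod>i=1..m. luxemburg_norm B Q (f i)) * ennreal y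
      \<le> ennpowr (ennpowr ?M q * (\<Sum>t\<in>UNIV. ?h t)) (1 / q)"
      by (simp only: c)
  qed
  then show ?thesis by (simp add: ennpowr_le_iff[OF \<open>0 < q\<close>])
qed

section \<open>The weighted inequality\<close>

theorem theorem2p15:
  fixes m :: nat and \<alpha> p q :: real and ps :: "nat \<Rightarrow> real"
    and B :: "real \<Rightarrow> real" and A C :: "nat \<Rightarrow> real \<Rightarrow> real"
    and \<nu> :: "real ^ 'n \<Rightarrow> real" and w :: "nat \<Rightarrow> real ^ 'n \<Rightarrow> real"
  assumes "1 \<le> m"
    and "0 \<le> \<alpha>" and "\<alpha> < real CARD('n) * real m"
    and "\<And>i. i \<in> {1..m} \<Longrightarrow> 1 < ps i"
    and "1 / p = (\<Sum>i=1..m. 1 / ps i)"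
    and "1 / real m < p" and "p \<le> q"
    and "young_function B"
    and "\<And>i. i \<in> {1..m} \<Longrightarrow> young_function (A i)"
    and "\<And>i. i \<in> {1..m} \<Longrightarrow> young_function (C i)"
    and "\<And>i t. i \<in> {1..m} \<Longrightarrow> 0 < t \<Longrightarrow> young_inv (A i) t * young_inv (C i) t \<le> young_inv B t"
    and "\<And>i. i \<in> {1..m} \<Longrightarrow> doubling (C i)"
    and "\<And>i. i \<in> {1..m} \<Longrightarrow> B_condition (ps i) (C i)"
    and "weight \<nu>"
    and "\<And>i. i \<in> {1..m} \<Longrightarrow> weight (w i)"
    and "\<And>i. i \<in> {1..m} \<Longrightarrow> AE x in lebesgue. 0 < w i x"
    and "(SUP Q\<in>cubes.
            ennreal (measure lebesgue Q powr (\<alpha> / real CARD('n) + 1 / q - 1 / p)) *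
            ennpowr ((\<integral>\<^sup>+ x\<in>Q. ennreal (\<nu> x powr q) \<partial>lebesgue) / emeasure lebesgue Q) (1 / q) *
            (\<Prod>i=1..m. luxemburg_norm (A i) Q (\<lambda>x. inverse (w i x)))) < \<infinity>"
  shows "\<exists>K>0. \<forall>f :: nat \<Rightarrow> real ^ 'n \<Rightarrow> complex.
           (\<forall>i\<in>{1..m}. f i \<in> weighted_Lp (ps i) (\<lambda>x. w i x powr ps i)) \<longrightarrow>
           Lp_norm q (\<lambda>x. multi_maximal \<alpha> B m f x * ennreal (\<nu> x)) \<le>
             ennreal K * (\<Prod>i=1..m. Lp_norm (ps i) (\<lambda>x. ennreal (norm (f i x) * w i x)))"
proof -
  note m = \<open>1 \<le> m\<close> and ps = \<open>\<And>i. i \<in> {1..m} \<Longrightarrow> 1 < ps i\<close> and p_eq = assms(5)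
    and B = \<open>young_function B\<close> and A = assms(9) and C = assms(10) and inv = assms(11)
  define \<beta> where "\<beta> = \<alpha> / real CARD('n)"
  have \<beta>: "0 \<le> \<beta>" using \<open>0 \<le> \<alpha>\<close> by (simp add: \<beta>_def)
  have "0 < 1 / real m" using m by simp
  then have p: "0 < p" using \<open>1 / real m < p\<close> by linarith
  then have q: "0 < q" using \<open>p \<le> q\<close> by linarith
  have r: "0 < ps i" if "i \<in> {1..m}" for i using ps[OF that] by simp
  have wm: "w i \<in> borel_measurable lebesgue" "\<And>x. 0 \<le> w i x" if "i \<in> {1..m}" for i
    using assms(15)[OF that] by (auto simp: weight_def)
  have \<nu>: "\<nu> \<in> borel_measurable lebesgue" "\<And>x. 0 \<le> \<nu> x" using \<open>weight \<nu>\<close> by (auto simp: weight_def)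
  define V where "V x = ennreal (\<nu> x powr q)" for x
  have V: "V \<in> borel_measurable lebesgue" unfolding V_def using \<nu>(1) by measurable
  define W where "W Q = ennreal (measure lebesgue Q powr (\<beta> + 1 / q - 1 / p)) *
    ennpowr ((\<integral>\<^sup>+ x\<in>Q. V x \<partial>lebesgue) / emeasure lebesgue Q) (1 / q) *
    (\<Prod>i=1..m. luxemburg_norm (A i) Q (\<lambda>x. inverse (w i x)))" for Q :: "(real ^ 'n) set"
  define K0 where "K0 = (SUP Q\<in>cubes. W Q)"
  have K0: "K0 < \<infinity>" using assms(17) unfolding K0_def W_def V_def \<beta>_def .
  \<comment> \<open>The supremum in the hypothesis runs over closed cubes. W sees a set only up to
    null sets, so the bound passes to half-open boxes.\<close>
  have W_dyadic: "W D \<le> K0" if D: "D \<in> dyadic_grid t" for D t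
  proof (rule dyadic_grid_cube[OF D])
    fix Q assume Q: "Q \<in> cubes" "AE x in lebesgue. x \<in> D \<longleftrightarrow> x \<in> Q"
      "emeasure lebesgue D = emeasure lebesgue Q"
    have "W D = W Q"
      unfolding W_def nn_integral_eq_AE_set[OF Q(2)] luxemburg_norm_eq_AE_set[OF Q(2,3)]
        measure_def Q(3) ..
    also have "\<dots> \<le> K0" unfolding K0_def by (rule SUP_upper[OF Q(1)])
    finally show "W D \<le> K0" .
  qed
  \<comment> \<open>The Carleson constants are fixed before f is introduced. They are needed for
    real functions, namely |f_i| w_i.\<close>
  have "\<forall>i\<in>{1..m}. \<exists>K>0. \<forall>(S :: (real ^ 'n) set set) (g :: real ^ 'n \<Rightarrow> real).
    finite S \<longrightarrow> laminar S \<longrightarrow> (\<forall>Q\<in>S. pos_lmeasurable Q) \<longrightarrow>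
    (\<forall>R\<in>S. 2 * emeasure lebesgue (\<Union>{Q\<in>S. Q \<subset> R}) \<le> emeasure lebesgue R) \<longrightarrow>
    g \<in> borel_measurable lebesgue \<longrightarrow>
    (\<Sum>Q\<in>S. emeasure lebesgue Q * ennpowr (luxemburg_norm (C i) Q g) (ps i))
      \<le> ennreal K * (\<integral>\<^sup>+x. ennreal (norm (g x) powr ps i) \<partial>lebesgue)"
    by (intro ballI luxemburg_norm_Carleson C assms(13) r)
  then obtain k where k: "\<And>i. i \<in> {1..m} \<Longrightarrow> 0 < k i"
    and Carleson: "\<And>i S g. i \<in> {1..m} \<Longrightarrow> finite S \<Longrightarrow> laminar S \<Longrightarrow> \<forall>Q\<in>S. pos_lmeasurable Q \<Longrightarrow>
      \<forall>R\<in>S. 2 * emeasure lebesgue (\<Union>{Q\<in>S. Q \<subset> R}) \<le> emeasure lebesgue R \<Longrightarrow>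
      g \<in> borel_measurable lebesgue \<Longrightarrow>
      (\<Sum>Q\<in>S. emeasure lebesgue Q * ennpowr (luxemburg_norm (C i) (Q :: (real ^ 'n) set) g) (ps i))
        \<le> ennreal (k i) * (\<integral>\<^sup>+x. ennreal (norm (g x :: real) powr ps i) \<partial>lebesgue)"
    unfolding bchoice_iff by blast
  \<comment> \<open>In order: the number 2^n of grids, the passage from cubes to boxes, the stopping
    ratio, Hoelder's inequality with the weight condition, and the Carleson embeddings. All are
    raised to the power q, the last ones to q / ps i.\<close>
  define L where "L = ennreal (real (card (UNIV :: ('n \<Rightarrow> bool) set))) * ennpowr (ennreal ((6 ^ CARD('n)) ^ m)) q *
    (ennpowr (ennreal ((4 * real m) ^ m)) q * ennpowr (2 ^ m * K0) q * (\<Prod>i=1..m. ennpowr (ennreal (k i)) (q / ps i)))"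
  have main: "Lp_norm q (\<lambda>x. multi_maximal \<alpha> B m f x * ennreal (\<nu> x)) \<le>
      ennpowr L (1 / q) * (\<Prod>i=1..m. Lp_norm (ps i) (\<lambda>x. ennreal (norm (f i x) * w i x)))"
    if f: "\<forall>i\<in>{1..m}. f i \<in> weighted_Lp (ps i) (\<lambda>x. w i x powr ps i)"
    for f :: "nat \<Rightarrow> real ^ 'n \<Rightarrow> complex"
  proof -
    define g where "g i x = norm (f i x) * w i x" for i x
    define c where "c Q = ennreal (measure lebesgue Q powr \<beta>) * (\<Prod>i=1..m. luxemburg_norm B Q (f i))" for Q
    define T where "T i = (\<integral>\<^sup>+x. ennreal (norm (g i x) powr ps i) \<partial>lebesgue)" for i
    define X where "X i Q = luxemburg_norm (C i) Q (g i)" for i Q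
    have fm: "f i \<in> borel_measurable lebesgue" if "i \<in> {1..m}" for i
      using f that by (auto simp: weighted_Lp_def)
    have gm: "g i \<in> borel_measurable lebesgue" if "i \<in> {1..m}" for i
      unfolding g_def using fm[OF that] wm(1)[OF that] by measurable
    have T: "T i < \<infinity>" if i: "i \<in> {1..m}" for i
    proof -
      have "T i = (\<integral>\<^sup>+x. ennreal (norm (f i x) powr ps i * w i x powr ps i) \<partial>lebesgue)"
        unfolding T_def g_def using wm(2)[OF i] by (intro nn_integral_cong) (simp add: abs_mult powr_mult)
      then show ?thesis using f i by (auto simp: weighted_Lp_def)
    qed
    have bound: "ennpowr (c D) q * (\<integral>\<^sup>+x\<in>D. V x \<partial>lebesgue)
        \<le> ennpowr (2 ^ m * K0) q * ennpowr (ennreal (measure lebesgue D powr (1 / p)) * (\<Prod>i=1..m. X i D)) q"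
      if D: "D \<in> dyadic_grid t" for D t
    proof -
      note Dm = pos_lmeasurable_dyadic_grid[OF D]
      show ?thesis
        unfolding c_def
      proof (rule weighted_term_le[OF q pos_lmeasurableD(5)[OF Dm]])
        fix i assume i: "i \<in> {1..m}"
        \<comment> \<open>Here f_i = (f_i w_i) / w_i is available only where w_i > 0, that is,
          almost everywhere.\<close>
        have "AE x in lebesgue. norm (f i x) \<le> norm (g i x) * norm (inverse (w i x))"
          using assms(16)[OF i] by eventually_elim (simp add: g_def abs_mult field_simps)
        then show "luxemburg_norm B D (f i)
            \<le> 2 * (X i D * luxemburg_norm (A i) D (\<lambda>x. inverse (w i x)))"
          unfolding X_def using wm(1)[OF i]
          by (intro luxemburg_norm_Hoelder[OF B A[OF i] C[OF i] inv[OF i] Dm fm[OF i] gm[OF i]]) auto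
      next
        show "ennreal (measure lebesgue D powr (\<beta> + 1 / q - 1 / p)) *
            ennpowr ((\<integral>\<^sup>+ x\<in>D. V x \<partial>lebesgue) / ennreal (measure lebesgue D)) (1 / q) *
            (\<Prod>i=1..m. luxemburg_norm (A i) D (\<lambda>x. inverse (w i x))) \<le> K0"
          using W_dyadic[OF D] unfolding W_def pos_lmeasurableD(4)[OF Dm] .
      qed
    qed
    let ?R = "ennpowr (ennreal ((4 * real m) ^ m)) q * ennpowr (2 ^ m * K0) q *
      (\<Prod>i=1..m. ennpowr (ennreal (k i) * T i) (q / ps i))"
    let ?h = "\<lambda>t x. (SUP D\<in>dyadic_grid t. ennpowr (c D) q * indicator D x) * V x"
    have h: "?h t \<in> borel_measurable lebesgue" "(\<integral>\<^sup>+x. ?h t x \<partial>lebesgue) \<le> ?R" for t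
    proof -
      have U: "ennreal (k i) * T i < \<infinity>" if "i \<in> {1..m}" for i
        using T[OF that] by (simp add: ennreal_mult_less_top)
      have Ca: "(\<Sum>Q\<in>S. emeasure lebesgue Q * ennpowr (X i Q) (ps i)) \<le> ennreal (k i) * T i"
        if "i \<in> {1..m}" "finite S" "laminar S" "\<forall>Q\<in>S. pos_lmeasurable Q"
          "\<forall>R\<in>S. 2 * emeasure lebesgue (\<Union>{Q\<in>S. Q \<subset> R}) \<le> emeasure lebesgue R" for i S
        unfolding X_def T_def by (rule Carleson[OF that gm[OF that(1)]])
      note * = countable_laminar_maximal_estimate[where c = c and X = X and U = "\<lambda>i. ennreal (k i) * T i",
          OF B countable_dyadic_grid laminar_dyadic_grid pos_lmeasurable_dyadic_grid fm \<beta> m c_def r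
            p p_eq \<open>p \<le> q\<close> V bound U Ca]
      show "?h t \<in> borel_measurable lebesgue" by (rule *(1))
      show "(\<integral>\<^sup>+x. ?h t x \<partial>lebesgue) \<le> ?R" by (rule *(2))
    qed
    have "(\<integral>\<^sup>+x. ennpowr (multi_maximal \<alpha> B m f x * ennreal (\<nu> x)) q \<partial>lebesgue)
        \<le> (\<integral>\<^sup>+x. ennpowr (ennreal ((6 ^ CARD('n)) ^ m)) q * (\<Sum>t\<in>UNIV. ?h t x) \<partial>lebesgue)"
      using \<nu>(2)
      by (intro nn_integral_mono multi_maximal_dyadic_le[OF B \<open>0 \<le> \<alpha>\<close> q fm]) (auto simp: c_def \<beta>_def V_def)
    also have "\<dots> = ennpowr (ennreal ((6 ^ CARD('n)) ^ m)) q * (\<Sum>t\<in>UNIV. \<integral>\<^sup>+x. ?h t x \<partial>lebesgue)"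
      using h(1) by (simp add: nn_integral_cmult nn_integral_sum)
    also have "\<dots> \<le> ennpowr (ennreal ((6 ^ CARD('n)) ^ m)) q * (\<Sum>t\<in>(UNIV :: ('n \<Rightarrow> bool) set). ?R)"
      by (intro mult_left_mono sum_mono h(2)) auto
    also have "\<dots> = L * (\<Prod>i=1..m. ennpowr (T i) (q / ps i))"
    proof -
      have "(\<Prod>i=1..m. ennpowr (ennreal (k i) * T i) (q / ps i))
          = (\<Prod>i=1..m. ennpowr (ennreal (k i)) (q / ps i)) * (\<Prod>i=1..m. ennpowr (T i) (q / ps i))"
        unfolding prod.distrib[symmetric] using r q by (intro prod.cong ennpowr_mult) auto
      then show ?thesis
        unfolding L_def by (simp add: ennreal_of_nat_eq_real_of_nat ac_simps)
    qed
    finally have "Lp_norm q (\<lambda>x. multi_maximal \<alpha> B m f x * ennreal (\<nu> x))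
        \<le> ennpowr (L * (\<Prod>i=1..m. ennpowr (T i) (q / ps i))) (1 / q)"
      unfolding Lp_norm_def using q by (intro ennpowr_mono) auto
    also have "\<dots> = ennpowr L (1 / q) * (\<Prod>i=1..m. ennpowr (T i) (1 / ps i))"
      using q by (simp add: ennpowr_mult ennpowr_prod ennpowr_ennpowr)
    also have "(\<Prod>i=1..m. ennpowr (T i) (1 / ps i)) = (\<Prod>i=1..m. Lp_norm (ps i) (\<lambda>x. ennreal (norm (f i x) * w i x)))"
      unfolding Lp_norm_def T_def g_def using wm(2)
      by (intro prod.cong refl arg_cong2[where f = ennpowr] nn_integral_cong) (simp add: ennpowr_ennreal abs_mult)
    finally show ?thesis .
  qed
  have "L < \<infinity>"
  proof -
    have fin: "ennpowr x s < top" if "x < top" for x s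
      using that by (simp add: ennpowr_def)
    have "(\<Prod>i=1..m. ennpowr (ennreal (k i)) (q / ps i)) = ennreal (\<Prod>i=1..m. k i powr (q / ps i))"
      using k by (simp add: ennpowr_ennreal less_imp_le prod_ennreal)
    then have "(\<Prod>i=1..m. ennpowr (ennreal (k i)) (q / ps i)) < top" by simp
    moreover have "2 ^ m * K0 < top"
      using K0 by (simp add: ennreal_mult_less_top power_less_top_ennreal)
    ultimately show ?thesis unfolding L_def by (auto intro!: fin simp: ennreal_mult_less_top)
  qed
  then obtain l where l: "ennpowr L (1 / q) = ennreal l" "0 \<le> l"
    by (cases L) (auto simp: ennpowr_ennreal)
  \<comment> \<open>L can be 0, and adding 1 yields a positive constant.\<close>
  have "ennpowr L (1 / q) \<le> ennreal (l + 1)" unfolding l(1) by (intro ennreal_leI) simp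
  then have "Lp_norm q (\<lambda>x. multi_maximal \<alpha> B m f x * ennreal (\<nu> x)) \<le>
      ennreal (l + 1) * (\<Prod>i=1..m. Lp_norm (ps i) (\<lambda>x. ennreal (norm (f i x) * w i x)))"
    if f: "\<forall>i\<in>{1..m}. f i \<in> weighted_Lp (ps i) (\<lambda>x. w i x powr ps i)"
    for f :: "nat \<Rightarrow> real ^ 'n \<Rightarrow> complex"
    by (rule order_trans[OF main[OF f] mult_right_mono]) simp
  then show ?thesis using l(2) by (intro exI[of _ "l + 1"]) auto
qed

end
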